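(* Fix any $B,C>0$ and let $f:\mathbb Z\to\mathbb C$ be any function satisfying, for all $n\in\mathbb Z$, $$|f(n)|\le B\,\tau(|n|)^C\ \text{ if } n\ne0,\qquad |f(n)|\le B\ \text{ if } n=0,$$ where $\tau$ is the divisor function. For any $N>0$ and any strictly positive integer $d$ there exists $\kappa=\kappa(B,C,d,N)>0$ such that for all $H\ge3$ and all $x$ in the range $(\log H)^{\kappa}\le x\le H$ we have $$\frac1{H^{1+d}}\sum_{F}\Bigg|\frac1{x^2}\sum_{\mathbf n\in\mathbb Z^2\cap[-x,x]^2}f(F(\mathbf n))\Bigg|^2\ll\frac{(\log H)^{\kappa}x^{4d}}{H^2}\max_{\substack{q\in\mathbb N\\ q\le 2x^{2d}}}\mathcal E_f\big((1+d)x^dH;q\big)^2+\frac1{(\log x)^N},$$ where $F$ runs over all binary forms in $\mathbb Z[t_1,t_2]$ of degree $d$ all of whose coefficients have absolute value at most $H$, where the implied constant depends only on $B,C,d,N$, and where $$\mathcal E_f(T;q):=\max_{r\in\mathbb Z/q\mathbb Z}\ \sup_{\substack{v\in\mathbb R\\|v|\le T}}\Bigg|\sum_{\substack{n\in\mathbb Z,\ -T\le n\le v\\ n\equiv r\ (\mathrm{mod}\ q)}}f(n)\Bigg|.$$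
   Context: $\mathbb N=\{1,2,\dots\}$. A binary form of degree $d$ is $F=\sum_{j=0}^d c_jt_1^jt_2^{d-j}$ (the zero form is allowed). $x$ and $H$ are real. $A\ll B$ means $|A|\le cB$ for a constant $c$ (the implied constant). *)

theory Defs
  imports "HOL-Analysis.Analysis" "HOL-Computational_Algebra.Polynomial" "HOL-Number_Theory.Cong"
begin

definition divisor_tau :: "nat \<Rightarrow> nat" where
  "divisor_tau n = card {d. d dvd n}"

text \<open>The ring of integer polynomials in \<open>t\<^sub>1, t\<^sub>2\<close> is the type \<open>int poly poly\<close>: the inner
  variable is \<open>t\<^sub>1\<close> and the outer variable is \<open>t\<^sub>2\<close>, so that \<open>monom (monom c j) i\<close> is
  \<open>c t\<^sub>1\<^sup>j t\<^sub>2\<^sup>i\<close>.\<close>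

definition eval2 :: "int poly poly \<Rightarrow> int \<times> int \<Rightarrow> int" where
  "eval2 F n = poly (poly F [:snd n:]) (fst n)"

definition is_binary_form :: "nat \<Rightarrow> int poly poly \<Rightarrow> bool" where
  "is_binary_form d F \<longleftrightarrow>
     (\<exists>c :: nat \<Rightarrow> int. F = (\<Sum>j=0..d. monom (monom (c j) j) (d - j)))"

definition binary_forms_upto :: "nat \<Rightarrow> real \<Rightarrow> int poly poly set" where
  "binary_forms_upto d H =
     {F. is_binary_form d F \<and> (\<forall>i j. \<bar>real_of_int (coeff (coeff F i) j)\<bar> \<le> H)}"

definition int_box :: "real \<Rightarrow> (int \<times> int) set" where
  "int_box x = {n. real_of_int (fst n) \<in> {-x..x} \<and> real_of_int (snd n) \<in> {-x..x}}"

text \<open>Used for \<open>T \<ge> 0\<close> and \<open>q \<ge> 1\<close> only. Then all maxima and suprema are over nonempty sets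
  taking finitely many values.\<close>

definition discrepancy :: "(int \<Rightarrow> complex) \<Rightarrow> real \<Rightarrow> nat \<Rightarrow> real" where
  "discrepancy f T q =
     (MAX r\<in>{0..<int q}. SUP v\<in>{v :: real. \<bar>v\<bar> \<le> T}.
        norm (\<Sum>n\<in>{n :: int. -T \<le> of_int n \<and> of_int n \<le> v \<and> [n = r] (mod int q)}. f n))"

end

theory Submission
  imports Defs
begin

text \<open>Expand the square. The left-hand side becomes \<open>x\<^sup>-\<^sup>4 H\<^sup>-\<^sup>1\<^sup>-\<^sup>d\<close> times the sum, over pairs of
points \<open>m, n\<close> of the box, of the correlations \<open>\<Sum>\<^sub>c f (F\<^sub>c m) * cnj (f (F\<^sub>c n))\<close>, where \<open>c\<close> runs over
the coefficient vectors. The pairs split according to the determinant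
\<open>D = m\<^sub>1\<^sup>d n\<^sub>2\<^sup>d - n\<^sub>1\<^sup>d m\<^sub>2\<^sup>d\<close> of the two end coefficients \<open>c\<^sub>d, c\<^sub>0\<close> in \<open>F\<^sub>c m\<close> and \<open>F\<^sub>c n\<close>.

If \<open>D \<noteq> 0\<close>, freeze the inner coefficients and group the pairs \<open>(c\<^sub>d, c\<^sub>0)\<close> by the value
\<open>u = F\<^sub>c m\<close>. The pairs with a given \<open>u\<close> are the lattice points of a segment, and along
this segment \<open>F\<^sub>c n\<close> takes, once each, all the values of a residue class in an interval; the
modulus is \<open>q = \<bar>D\<bar> / gcd (m\<^sub>1\<^sup>d) (m\<^sub>2\<^sup>d) \<le> 2 x\<^sup>2\<^sup>d\<close>. So the sum over the fibre is at most twice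
the discrepancy, and the correlation is small on average against \<open>\<Sum>\<^sub>u \<bar>f u\<bar>\<close>
(\<open>bilinear_sum_le_discrepancy\<close>, \<open>form_correlation_le_discrepancy\<close>). Altogether these pairs contribute
\<open>E x\<^sup>d (log H)\<^sup>A / H\<close>, with \<open>E\<close> the largest discrepancy. This is linear in \<open>E\<close>; the quadratic bound
with the error \<open>(log x)\<^sup>-\<^sup>N\<close> comes from \<open>X \<le> X\<^sup>2 s + 1 / s\<close> with \<open>s = (log x)\<^sup>N\<close>.

If \<open>D = 0\<close>, there is no cancellation to exploit, but there are only \<open>O(x\<^sup>3)\<close> such pairs among \<open>x\<^sup>4\<close>
(\<open>card_degenerate_pairs\<close>). By Cauchy-Schwarz it suffices that the mean square of \<open>f (F\<^sub>c n)\<close> over \<open>c\<close> is at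
most \<open>(log H)\<^sup>A x\<^sup>1\<^sup>/\<^sup>4\<close> for each fixed \<open>n\<close> (\<open>form_moment\<close>); a power of \<open>x\<close> is then saved, which beats
\<open>(log H)\<^sup>A\<close> because \<open>x \<ge> (log H)\<^sup>\<kappa>\<close>.

The moment bound concerns the divisor function on a progression \<open>a c + b\<close> with \<open>\<bar>c\<bar> \<le> H\<close> whose
terms are as large as a fixed power \<open>H\<^sup>k\<close>. It rests on the fact that \<open>\<tau> n\<close> is dominated by a
power of \<open>\<tau> e\<close> for some divisor \<open>e \<le> H\<close> of \<open>n\<close> (\<open>divisor_tau_le_small_divisor\<close>), because the number of
\<open>c\<close> for which such a small \<open>e\<close> divides \<open>a c + b\<close> is easy to control.\<close>

section \<open>The divisor function\<close>

lemma finite_divisors_pos: "n > 0 \<Longrightarrow> finite {d::nat. d dvd n}"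
  by (rule finite_subset[of _ "{..n}"]) (auto dest: dvd_imp_le)

lemma divisor_tau_pos: "n > 0 \<Longrightarrow> divisor_tau n \<ge> 1"
  unfolding divisor_tau_def using finite_divisors_pos[of n]
  by (force simp: Suc_le_eq card_gt_0_iff)

lemma divisor_tau_mono: "a dvd n \<Longrightarrow> n > 0 \<Longrightarrow> divisor_tau a \<le> divisor_tau n"
  unfolding divisor_tau_def
  by (rule card_mono) (simp add: finite_divisors_pos, blast intro: dvd_trans)

lemma divisor_tau_mult_le:
  assumes "m > 0" "n > 0"
  shows "divisor_tau (m * n) \<le> divisor_tau m * divisor_tau n"
proof -
  have "{d. d dvd m * n} \<subseteq> (\<lambda>(a, b). a * b) ` ({d. d dvd m} \<times> {d. d dvd n})"
  proof
    fix e assume "e \<in> {d. d dvd m * n}"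
    then obtain a b where "e = a * b" "a dvd m" "b dvd n" using division_decomp by blast
    then show "e \<in> (\<lambda>(a, b). a * b) ` ({d. d dvd m} \<times> {d. d dvd n})" by auto
  qed
  then have "card {d. d dvd m * n} \<le> card ({d. d dvd m} \<times> {d. d dvd n})"
    using assms by (intro surj_card_le) (auto simp: finite_divisors_pos)
  then show ?thesis
    by (simp add: divisor_tau_def card_cartesian_product)
qed

lemma divisor_tau_prime:
  assumes "prime p"
  shows "divisor_tau p = 2"
proof -
  have "{d. d dvd p} = {1, p}" using assms by (auto simp: prime_nat_iff)
  moreover have "p \<noteq> 1" using assms by auto
  ultimately show ?thesis by (simp only: divisor_tau_def card_2_iff) blast
qed

text \<open>An upper bound for \<open>\<tau>\<close> by a divisor below \<open>y\<close>: let \<open>e\<close> be the largest divisor of \<open>n\<close> with \<open>e \<le> y\<close>. Either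
\<open>e = n\<close>, or any prime \<open>p\<close> dividing \<open>n / e\<close> satisfies \<open>e p > y\<close>, so that the cofactor of \<open>e p\<close>
is at most \<open>y\<^sup>k\<^sup>-\<^sup>1\<close> and induction applies to it; each round costs a factor \<open>\<tau> p = 2\<close> and
one value \<open>\<tau> e\<close>, and all of these values are bounded by the largest one.\<close>

lemma divisor_tau_le_small_divisor:
  fixes y :: real
  assumes "y \<ge> 1" "n > 0" "real n \<le> y ^ k"
  shows "\<exists>e. e dvd n \<and> real e \<le> y \<and> divisor_tau n \<le> (2 * divisor_tau e) ^ k"
  using assms(2,3)
proof (induction k arbitrary: n)
  case 0
  then have "n = 1" by simp
  then show ?case using assms(1) by (intro exI[of _ 1]) (auto simp: divisor_tau_def)
next
  case (Suc k)
  define e where "e = Max {e. e dvd n \<and> real e \<le> y}"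
  have fin: "finite {e. e dvd n \<and> real e \<le> y}"
    by (rule finite_subset[OF _ finite_divisors_pos[OF Suc.prems(1)]]) auto
  have "1 \<in> {e. e dvd n \<and> real e \<le> y}" using assms(1) by simp
  then have "e \<in> {e. e dvd n \<and> real e \<le> y}"
    unfolding e_def using Max_in[OF fin] by blast
  then have e: "e dvd n" "real e \<le> y" by auto
  have e_max: "e' \<le> e" if "e' dvd n" "real e' \<le> y" for e'
    unfolding e_def using fin that by (intro Max_ge) auto
  have e0: "e > 0" using e Suc.prems by (auto intro: Nat.gr0I)
  have te: "divisor_tau e \<ge> 1" using divisor_tau_pos e0 by simp
  show ?case
  proof (cases "e = n")
    case True
    have "divisor_tau n \<le> (2 * divisor_tau n) ^ 1" by simp
    also have "\<dots> \<le> (2 * divisor_tau n) ^ Suc k"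
      using te True by (intro power_increasing) auto
    finally show ?thesis using e True by (intro exI[of _ n]) simp
  next
    case False
    obtain m where m: "n = e * m" using e by blast
    have "m \<noteq> 1" using False m by auto
    then obtain p where p: "prime p" "p dvd m" using prime_factor_nat by blast
    then obtain l where l: "m = p * l" by blast
    have l0: "l > 0" using Suc.prems m l by (auto intro: Nat.gr0I)
    have p2: "p \<ge> 2" using p prime_ge_2_nat by blast
    have "real (e * p) > y"
    proof (rule ccontr)
      assume "\<not> ?thesis"
      then have "e * p \<le> e" by (intro e_max) (auto simp: m l)
      then show False using e0 p2 by auto
    qed
    then have "y * real l \<le> real (e * p) * real l"
      by (intro mult_right_mono) auto
    also have "\<dots> \<le> y * y ^ k" using Suc.prems m l by (simp add: mult.assoc)
    finally have "real l \<le> y ^ k" using assms(1) by simp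
    from Suc.IH[OF l0 this] obtain e' where e':
      "e' dvd l" "real e' \<le> y" "divisor_tau l \<le> (2 * divisor_tau e') ^ k" by blast
    define b where "b = (if divisor_tau e' \<le> divisor_tau e then e else e')"
    have b: "divisor_tau e \<le> divisor_tau b" "divisor_tau e' \<le> divisor_tau b"
      by (auto simp: b_def)
    have "divisor_tau n = divisor_tau (e * (p * l))" by (simp add: m l)
    also have "\<dots> \<le> divisor_tau e * divisor_tau (p * l)"
      using e0 p2 l0 by (intro divisor_tau_mult_le) auto
    also have "\<dots> \<le> divisor_tau e * (divisor_tau p * divisor_tau l)"
      using e0 p2 l0 by (intro mult_left_mono divisor_tau_mult_le) auto
    also have "\<dots> = (2 * divisor_tau e) * divisor_tau l" using p divisor_tau_prime by simp
    also have "\<dots> \<le> (2 * divisor_tau b) * (2 * divisor_tau b) ^ k"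
      using b order_trans[OF e'(3) power_mono[of "2 * divisor_tau e'" "2 * divisor_tau b" k]]
      by (intro mult_mono) auto
    finally have "divisor_tau n \<le> (2 * divisor_tau b) ^ Suc k" by simp
    moreover have "b dvd n" using e e' m l by (auto simp: b_def)
    moreover have "real b \<le> y" using e e' by (auto simp: b_def)
    ultimately show ?thesis by blast
  qed
qed

text \<open>Moments of \<open>\<tau>\<close> with logarithmic weights square when the exponent grows by one: writing one factor
\<open>\<tau> j\<close> as a sum over \<open>e dvd j\<close> and \<open>j = e * k\<close>, submultiplicativity separates the variables \<open>e\<close> and \<open>k\<close>.\<close>

lemma divisor_tau_moment_le_harm:
  "(\<Sum>j=1..n. real (divisor_tau j) ^ R / real j) \<le> harm n ^ (2 ^ R)"
proof (induction R)
  case 0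
  then show ?case by (simp add: harm_def divide_inverse)
next
  case (Suc R)
  let ?g = "\<lambda>j. real (divisor_tau j) ^ R / real j"
  have "(\<Sum>j=1..n. real (divisor_tau j) ^ Suc R / real j)
      = (\<Sum>j=1..n. \<Sum>e\<in>{e. e dvd j}. ?g j)"
    by (intro sum.cong) (auto simp: divisor_tau_def)
  also have "\<dots> = (\<Sum>(j, e)\<in>(SIGMA j:{1..n}. {e. e dvd j}). ?g j)"
    by (rule sum.Sigma) (auto simp: finite_divisors_pos)
  also have "\<dots> \<le> (\<Sum>(e, k)\<in>{1..n} \<times> {1..n}. ?g e * ?g k)"
  proof (rule sum_le_included[where i = "\<lambda>(e, k). (e * k, e)"], goal_cases)
    case 1
    then show ?case by (intro finite_SigmaI) (auto simp: finite_divisors_pos)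
  next
    case 4
    show ?case
    proof (safe, goal_cases)
      case (1 j e)
      then obtain k where k: "j = e * k" by blast
      have pos: "e > 0" "k > 0" using 1 k by (auto intro!: Nat.gr0I)
      have "e \<le> j" "k \<le> j" using k pos by auto
      then have le: "e \<le> n" "k \<le> n" using 1 by auto
      have "real (divisor_tau j) ^ R \<le> real (divisor_tau e * divisor_tau k) ^ R"
        unfolding k using divisor_tau_mult_le[OF pos] by (intro power_mono) (auto simp del: of_nat_mult)
      then have "?g j \<le> ?g e * ?g k" using pos
        by (simp add: k divide_right_mono power_mult_distrib)
      then show ?case using k pos le by (intro bexI[of _ "(e, k)"]) auto
    qed
  qed auto
  also have "\<dots> = (\<Sum>j=1..n. ?g j)\<^sup>2"
    unfolding power2_eq_square sum_product by (rule sum.cartesian_product[symmetric])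
  also have "\<dots> \<le> (harm n ^ (2 ^ R))\<^sup>2"
    using Suc by (intro power_mono sum_nonneg) auto
  also have "\<dots> = harm n ^ (2 ^ Suc R)"
    by (simp add: power_mult[symmetric] mult.commute)
  finally show ?case .
qed

lemma divisor_tau_moment:
  fixes y :: real
  assumes "y \<ge> 1"
  shows "(\<Sum>j=1..nat \<lfloor>y\<rfloor>. real (divisor_tau j) ^ R / real j) \<le> (1 + ln y) ^ (2 ^ R)"
proof -
  define n where "n = nat \<lfloor>y\<rfloor>"
  have n: "n \<ge> 1" "real n \<le> y" using assms by (auto simp: n_def le_nat_floor)
  have "harm n \<le> ln (real n) + 1" using euler_mascheroni_sequence_decreasing[of 1 n] n by (simp add: harm_def)
  also have "\<dots> \<le> 1 + ln y" using n by simp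
  finally have "(harm n :: real) \<le> 1 + ln y" .
  then have "harm n ^ (2 ^ R) \<le> (1 + ln y) ^ (2 ^ R)"
    by (intro power_mono) (auto simp: harm_nonneg)
  then show ?thesis using divisor_tau_moment_le_harm[of R n] by (simp add: n_def)
qed

lemma one_plus_ln_power_bound:
  fixes \<delta> :: real
  assumes "\<delta> > 0"
  shows "\<exists>K\<ge>1. \<forall>x\<ge>1. (1 + ln x) ^ A \<le> K * x powr \<delta>"
proof (cases "A = 0")
  case True
  then show ?thesis using assms by (intro exI[of _ 1]) (auto simp: ge_one_powr_ge_zero)
next
  case False
  define a where "a = \<delta> / real A"
  have a: "a > 0" using assms False by (simp add: a_def)
  have "(1 + ln x) ^ A \<le> (1 + 1 / a) ^ A * x powr \<delta>" if x: "x \<ge> 1" for x :: real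
  proof -
    have "1 \<le> x powr a" using x a by (simp add: ge_one_powr_ge_zero)
    moreover have "ln x \<le> x powr a / a" using ln_powr_bound x a by blast
    ultimately have "1 + ln x \<le> (1 + 1 / a) * x powr a" by (simp add: algebra_simps)
    then have "(1 + ln x) ^ A \<le> ((1 + 1 / a) * x powr a) ^ A"
      using x by (intro power_mono) auto
    also have "\<dots> = (1 + 1 / a) ^ A * x powr \<delta>"
      using x False by (simp add: power_mult_distrib powr_power a_def)
    finally show ?thesis .
  qed
  then show ?thesis using a by (intro exI[of _ "(1 + 1 / a) ^ A"]) (auto simp: one_le_power)
qed

text \<open>The classical bound \<open>\<tau> n \<le> K n\<^sup>\<epsilon>\<close>, read off from one term of a high moment: \<open>\<tau> n ^ S / n\<close> is
at most a power of a logarithm, hence \<open>O(n)\<close>, and \<open>S\<close>-th roots of \<open>n\<^sup>2\<close> are arbitrarily small powers of \<open>n\<close>.\<close>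

lemma divisor_tau_power_bound:
  fixes \<epsilon> :: real
  assumes "\<epsilon> > 0"
  shows "\<exists>K\<ge>1. \<forall>n\<ge>1. real (divisor_tau n) ^ R \<le> K * real n powr \<epsilon>"
proof -
  define S where "S = Suc (nat \<lceil>2 * real R / \<epsilon>\<rceil>)"
  have S: "2 * real R / \<epsilon> \<le> real S" "S > 0"
    unfolding S_def by linarith+
  obtain K :: real where K: "K \<ge> 1" "\<And>x. x \<ge> 1 \<Longrightarrow> (1 + ln x) ^ (2 ^ S) \<le> K * x powr 1"
    using one_plus_ln_power_bound[of 1 "2 ^ S"] by (metis zero_less_one)
  have "real (divisor_tau n) ^ R \<le> K powr (real R / real S) * real n powr \<epsilon>" if n: "n \<ge> 1" for n
  proof -
    have t: "real (divisor_tau n) > 0" using divisor_tau_pos[of n] n by simp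
    have "real (divisor_tau n) ^ S / real n \<le> (\<Sum>j=1..nat \<lfloor>real n\<rfloor>. real (divisor_tau j) ^ S / real j)"
      using n by (intro member_le_sum) auto
    also have "\<dots> \<le> (1 + ln (real n)) ^ (2 ^ S)" using n by (intro divisor_tau_moment) auto
    also have "\<dots> \<le> K * real n powr 1" using n by (intro K(2)) auto
    finally have "real (divisor_tau n) ^ S \<le> K * real n powr 2"
      using n by (simp add: field_simps power2_eq_square)
    then have "(real (divisor_tau n) ^ S) powr (real R / real S) \<le> (K * real n powr 2) powr (real R / real S)"
      using t by (intro powr_mono2) auto
    also have "(real (divisor_tau n) ^ S) powr (real R / real S) = real (divisor_tau n) ^ R"
      using t S by (simp add: powr_powr flip: powr_realpow)
    also have "(K * real n powr 2) powr (real R / real S)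
        = K powr (real R / real S) * real n powr (2 * real R / real S)"
      using K n by (simp only: powr_mult powr_powr) simp
    also have "\<dots> \<le> K powr (real R / real S) * real n powr \<epsilon>"
      using S n assms by (intro mult_left_mono powr_mono) (auto simp: field_simps)
    finally show ?thesis .
  qed
  moreover have "K powr (real R / real S) \<ge> 1" using K by (intro ge_one_powr_ge_zero) auto
  ultimately show ?thesis by blast
qed

section \<open>Divisor moments along arithmetic progressions\<close>

text \<open>The solutions \<open>c\<close> lie in one residue class modulo \<open>q = e / gcd a e\<close>, and \<open>c \<mapsto> c div q\<close> is injective
on a residue class. The hypothesis \<open>e \<le> Y\<close> absorbs the rounding error into the main term \<open>2 Y / q\<close>.\<close>

lemma card_progression_solutions:
  fixes a b :: int and Y :: real
  assumes "e > 0" "real e \<le> Y" 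
  shows "real (card {c\<in>{-\<lfloor>Y\<rfloor>..\<lfloor>Y\<rfloor>}. int e dvd a * c + b}) \<le> 4 * Y * real (gcd (nat \<bar>a\<bar>) e) / real e"
proof -
  define g where "g = gcd a (int e)"
  obtain q where q: "int e = g * q" unfolding g_def by (meson gcd_dvd2 dvdE)
  obtain a' where a': "a = g * a'" unfolding g_def by (meson gcd_dvd1 dvdE)
  have g: "g > 0" using assms by (auto simp: g_def)
  have qpos: "q > 0" using q g assms by (metis of_nat_0_less_iff zero_less_mult_pos)
  have g_nat: "real (gcd (nat \<bar>a\<bar>) e) = of_int g"
    by (simp add: g_def flip: gcd_int_int_eq)
  define h where "h = \<lfloor>Y\<rfloor>"
  let ?S = "{c\<in>{-h..h}. int e dvd a * c + b}"
  have "coprime a' q"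
  proof -
    have "gcd (g * a') (g * q) = g" by (metis q a' g_def)
    then have "g * gcd a' q = g" using g by (simp add: gcd_mult_left)
    then show ?thesis using g by (simp add: coprime_iff_gcd_eq_1)
  qed
  have cong: "q dvd c - c'" if "int e dvd a * c + b" "int e dvd a * c' + b" for c c'
  proof -
    have "int e dvd (a * c + b) - (a * c' + b)" using that by (rule dvd_diff)
    then have "g * q dvd g * (a' * (c - c'))" using q a' by (simp add: algebra_simps)
    then have "q dvd a' * (c - c')" using g by simp
    then show ?thesis using \<open>coprime a' q\<close> by (simp add: coprime_commute coprime_dvd_mult_right_iff)
  qed
  have inj: "inj_on (\<lambda>c. c div q) ?S"
  proof (rule inj_onI)
    fix c c' assume "c \<in> ?S" "c' \<in> ?S" and eq: "c div q = c' div q"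
    then have "c mod q = c' mod q" using cong mod_eq_dvd_iff by blast
    with eq show "c = c'" by (metis div_mult_mod_eq)
  qed
  have "(\<lambda>c. c div q) ` ?S \<subseteq> {(-h) div q..h div q}"
    using qpos by (auto intro: zdiv_mono1)
  then have "card ?S \<le> card {(-h) div q..h div q}"
    using inj by (intro card_inj_on_le) auto
  also have "\<dots> = nat (h div q - (-h) div q + 1)" by simp
  finally have "int (card ?S) \<le> h div q - (-h) div q + 1"
    using qpos assms zdiv_mono1[of "-h" h q] by (simp add: h_def)
  then have "real (card ?S) \<le> of_int (h div q - (-h) div q + 1)"
    by linarith
  also have "\<dots> \<le> 4 * Y / of_int q"
  proof -
    have hY: "real_of_int h \<le> Y" unfolding h_def by simp
    have 1: "real_of_int (h div q) \<le> of_int h / of_int q"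
      by (rule real_of_int_div4)
    have "real_of_int ((-h) div q) = of_int \<lfloor>real_of_int (-h) / of_int q\<rfloor>"
      by (simp only: floor_divide_of_int_eq)
    then have 2: "real_of_int ((-h) div q) \<ge> - of_int h / of_int q - 1"
      by linarith
    have 3: "of_int h / of_int q \<le> Y / of_int q"
      using qpos hY by (intro divide_right_mono) auto
    have "q \<le> int e" using q g qpos by simp
    then have "real_of_int q \<le> real e" by linarith
    then have "real_of_int q \<le> Y" using assms by linarith
    then have "1 \<le> Y / of_int q" using qpos by simp
    then show ?thesis using 1 2 3 by simp
  qed
  also have "\<dots> = 4 * Y * of_int g / (of_int g * of_int q)" using g by simp
  also have "of_int g * of_int q = real e" using arg_cong[OF q, of real_of_int] by simp
  finally show ?thesis by (simp only: g_nat h_def)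
qed

text \<open>Writing \<open>e = g * j\<close> with \<open>g = gcd a e\<close> cancels the factor \<open>g\<close> and leaves one moment sum for each divisor
\<open>g\<close> of \<open>a\<close>.\<close>

lemma sum_divisor_tau_gcd_le:
  assumes "a > 0"
  shows "(\<Sum>e=1..n. real (divisor_tau e) ^ K * real (gcd a e) / real e)
    \<le> real (divisor_tau a) ^ Suc K * (\<Sum>j=1..n. real (divisor_tau j) ^ K / real j)"
proof -
  let ?g = "\<lambda>j. real (divisor_tau j) ^ K / real j"
  have "(\<Sum>e=1..n. real (divisor_tau e) ^ K * real (gcd a e) / real e)
      \<le> (\<Sum>(g, j)\<in>{g. g dvd a} \<times> {1..n}. real (divisor_tau a) ^ K * ?g j)"
  proof (rule sum_le_included[where i = "\<lambda>(g, j). g * j"], goal_cases)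
    case 2
    then show ?case by (intro finite_SigmaI) (auto simp: finite_divisors_pos assms)
  next
    case 4
    show ?case
    proof (safe, goal_cases)
      case (1 e)
      define g where "g = gcd a e"
      have ga: "g dvd a" "g dvd e" by (simp_all add: g_def)
      then obtain j where j: "e = g * j" by blast
      have pos: "g > 0" "j > 0" using 1 j by (auto intro!: Nat.gr0I)
      have "j \<le> e" using j pos by simp
      then have "j \<in> {1..n}" using 1 pos by auto
      have "divisor_tau e \<le> divisor_tau g * divisor_tau j"
        unfolding j by (rule divisor_tau_mult_le[OF pos])
      also have "\<dots> \<le> divisor_tau a * divisor_tau j"
        using divisor_tau_mono[OF ga(1) assms] by simp
      finally have "real (divisor_tau e) ^ K \<le> real (divisor_tau a * divisor_tau j) ^ K"
        by (intro power_mono) (auto simp del: of_nat_mult)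
      then have "real (divisor_tau e) ^ K * real g / real e \<le> real (divisor_tau a) ^ K * ?g j"
        using pos by (simp add: j divide_right_mono power_mult_distrib)
      then have "real (divisor_tau e) ^ K * real (gcd a e) / real e \<le> real (divisor_tau a) ^ K * ?g j"
        by (simp only: g_def)
      then show ?case using \<open>j \<in> {1..n}\<close> j[symmetric] ga(1) by (intro bexI[of _ "(g, j)"]) auto
    qed
  qed auto
  also have "\<dots> = (\<Sum>g\<in>{g. g dvd a}. \<Sum>j=1..n. real (divisor_tau a) ^ K * ?g j)"
    by (rule sum.cartesian_product[symmetric])
  also have "\<dots> = real (divisor_tau a) ^ Suc K * (\<Sum>j=1..n. ?g j)"
    by (simp add: divisor_tau_def sum_distrib_left mult_ac)
  finally show ?thesis .
qed

text \<open>A power of this weight, times \<open>B\<close>, dominates \<open>norm (f n)\<close> for every integer \<open>n\<close>. The set of divisors of \<open>0\<close> is infinite, so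
\<open>divisor_tau 0 = 0\<close>; the maximum replaces this value by \<open>1\<close>, in accordance with \<open>norm (f 0) \<le> B\<close>.\<close>

definition tau_weight :: "int \<Rightarrow> nat" where
  "tau_weight n = max 1 (divisor_tau (nat \<bar>n\<bar>))"

text \<open>The weight of each term is dominated by a power of \<open>\<tau> e\<close> for some \<open>e \<le> Y\<close> dividing that term;
summing over all such \<open>e\<close> and exchanging the sums reduces the claim to counting the \<open>c\<close> with
\<open>e dvd a * c + b\<close>. Common factors of \<open>a\<close> and \<open>b\<close> are paid for by the power of \<open>\<tau> a\<close>.\<close>

lemma tau_weight_moment_progression:
  fixes a b :: int and Y :: real
  assumes "Y \<ge> 1" "a \<noteq> 0"
    and bound: "\<And>c. c \<in> {-\<lfloor>Y\<rfloor>..\<lfloor>Y\<rfloor>} \<Longrightarrow> \<bar>real_of_int (a * c + b)\<bar> \<le> Y ^ k"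
  shows "(\<Sum>c\<in>{-\<lfloor>Y\<rfloor>..\<lfloor>Y\<rfloor>}. real (tau_weight (a * c + b)) ^ R)
    \<le> 4 * 2 ^ (R * k) * Y * real (divisor_tau (nat \<bar>a\<bar>)) ^ Suc (R * k) * (1 + ln Y) ^ (2 ^ (R * k))"
proof -
  define K where "K = R * k"
  let ?I = "{-\<lfloor>Y\<rfloor>..\<lfloor>Y\<rfloor>}" and ?E = "{1..nat \<lfloor>Y\<rfloor>}"
  have E: "e \<in> ?E" if "e > 0" "real e \<le> Y" for e
    using that by (auto simp: le_nat_floor)
  have E': "real e \<le> Y" if "e \<in> ?E" for e
  proof -
    have "real e \<le> real (nat \<lfloor>Y\<rfloor>)" using that by simp
    also have "\<dots> \<le> Y" using assms(1) by (intro of_nat_floor) simp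
    finally show ?thesis .
  qed
  have pointwise: "real (tau_weight n) ^ R \<le> 2 ^ K * (\<Sum>e\<in>?E. if int e dvd n then real (divisor_tau e) ^ K else 0)"
    if n: "\<bar>real_of_int n\<bar> \<le> Y ^ k" for n
  proof -
    have "\<exists>e\<in>?E. int e dvd n \<and> tau_weight n \<le> (2 * divisor_tau e) ^ k"
    proof (cases "n = 0")
      case True
      have "1 \<in> ?E" using E[of 1] assms by simp
      then show ?thesis using True
        by (intro bexI[of _ 1]) (auto simp: tau_weight_def divisor_tau_def)
    next
      case False
      have "real (nat \<bar>n\<bar>) \<le> Y ^ k" using n by simp
      then obtain e where e: "e dvd nat \<bar>n\<bar>" "real e \<le> Y" "divisor_tau (nat \<bar>n\<bar>) \<le> (2 * divisor_tau e) ^ k"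
        using divisor_tau_le_small_divisor[OF assms(1), of "nat \<bar>n\<bar>" k] False by auto
      have e0: "e > 0" using e(1) False by (auto intro!: Nat.gr0I)
      have "1 \<le> (2 * divisor_tau e) ^ k" using divisor_tau_pos[OF e0] by (simp add: one_le_power)
      moreover have "int e dvd n" using e(1) by (simp add: int_dvd_int_iff[symmetric])
      ultimately show ?thesis using e E[OF e0] by (auto simp: tau_weight_def)
    qed
    then obtain e where e: "e \<in> ?E" "int e dvd n" "tau_weight n \<le> (2 * divisor_tau e) ^ k" by blast
    have "real (tau_weight n) ^ R \<le> (real ((2 * divisor_tau e) ^ k)) ^ R"
      using e(3) by (intro power_mono of_nat_mono) auto
    also have "\<dots> = 2 ^ K * (if int e dvd n then real (divisor_tau e) ^ K else 0)"
      using e by (simp add: K_def power_mult_distrib power_mult[symmetric] mult.commute)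
    also have "\<dots> \<le> 2 ^ K * (\<Sum>e\<in>?E. if int e dvd n then real (divisor_tau e) ^ K else 0)"
      using e by (intro mult_left_mono member_le_sum) auto
    finally show ?thesis .
  qed
  have "(\<Sum>c\<in>?I. real (tau_weight (a * c + b)) ^ R)
      \<le> (\<Sum>c\<in>?I. 2 ^ K * (\<Sum>e\<in>?E. if int e dvd a * c + b then real (divisor_tau e) ^ K else 0))"
    using pointwise bound by (intro sum_mono) blast
  also have "\<dots> = 2 ^ K * (\<Sum>c\<in>?I. \<Sum>e\<in>?E. if int e dvd a * c + b then real (divisor_tau e) ^ K else 0)"
    by (rule sum_distrib_left[symmetric])
  also have "\<dots> = 2 ^ K * (\<Sum>e\<in>?E. \<Sum>c\<in>?I. if int e dvd a * c + b then real (divisor_tau e) ^ K else 0)"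
    by (subst sum.swap) (rule refl)
  also have "\<dots> = 2 ^ K * (\<Sum>e\<in>?E. real (divisor_tau e) ^ K * real (card {c\<in>?I. int e dvd a * c + b}))"
    by (simp add: sum.inter_filter[symmetric] mult.commute)
  also have "\<dots> \<le> 2 ^ K * (\<Sum>e\<in>?E. real (divisor_tau e) ^ K * (4 * Y * real (gcd (nat \<bar>a\<bar>) e) / real e))"
    using E' by (intro mult_left_mono sum_mono card_progression_solutions) auto
  also have "\<dots> = 4 * 2 ^ K * Y * (\<Sum>e\<in>?E. real (divisor_tau e) ^ K * real (gcd (nat \<bar>a\<bar>) e) / real e)"
    by (simp add: sum_distrib_left algebra_simps)
  also have "\<dots> \<le> 4 * 2 ^ K * Y * (real (divisor_tau (nat \<bar>a\<bar>)) ^ Suc K * (\<Sum>j\<in>?E. real (divisor_tau j) ^ K / real j))"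
    using assms by (intro mult_left_mono sum_divisor_tau_gcd_le) auto
  also have "\<dots> \<le> 4 * 2 ^ K * Y * (real (divisor_tau (nat \<bar>a\<bar>)) ^ Suc K * (1 + ln Y) ^ (2 ^ K))"
    using assms by (intro mult_left_mono divisor_tau_moment) auto
  finally show ?thesis by (simp add: K_def mult.assoc)
qed

section \<open>Bilinear sums and discrepancies\<close>

lemma finite_int_le_real: "finite {n :: int. a \<le> real_of_int n \<and> real_of_int n \<le> b \<and> P n}"
  by (rule finite_subset[of _ "{\<lceil>a\<rceil>..\<lfloor>b\<rfloor>}"]) (auto simp: ceiling_le_iff le_floor_iff)

lemma norm_sum_le_discrepancy:
  fixes v T :: real and r :: int
  assumes "q \<ge> 1" "\<bar>v\<bar> \<le> T"
  shows "norm (\<Sum>n\<in>{n :: int. -T \<le> of_int n \<and> of_int n \<le> v \<and> [n = r] (mod int q)}. f n)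
    \<le> discrepancy f T q"
proof -
  let ?S = "\<lambda>r v. {n :: int. -T \<le> of_int n \<and> of_int n \<le> v \<and> [n = r] (mod int q)}"
  let ?V = "{v :: real. \<bar>v\<bar> \<le> T}"
  have bdd: "bdd_above ((\<lambda>v. norm (\<Sum>n\<in>?S r v. f n)) ` ?V)" for r
  proof (rule bdd_aboveI2)
    fix v assume "v \<in> ?V"
    have "norm (\<Sum>n\<in>?S r v. f n) \<le> (\<Sum>n\<in>?S r v. norm (f n))" by (rule norm_sum)
    also have "\<dots> \<le> (\<Sum>n\<in>{n :: int. -T \<le> of_int n \<and> of_int n \<le> T \<and> True}. norm (f n))"
      using \<open>v \<in> ?V\<close> by (intro sum_mono2 finite_int_le_real) auto
    finally show "norm (\<Sum>n\<in>?S r v. f n)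
      \<le> (\<Sum>n\<in>{n :: int. -T \<le> of_int n \<and> of_int n \<le> T \<and> True}. norm (f n))" .
  qed
  define r' where "r' = r mod int q"
  have r': "r' \<in> {0..<int q}" using assms by (simp add: r'_def)
  have "?S r v = ?S r' v" by (simp add: r'_def cong_def)
  then have "norm (\<Sum>n\<in>?S r v. f n) = norm (\<Sum>n\<in>?S r' v. f n)" by simp
  also have "\<dots> \<le> (SUP v\<in>?V. norm (\<Sum>n\<in>?S r' v. f n))"
    using assms(2) by (intro cSUP_upper bdd) auto
  also have "\<dots> \<le> discrepancy f T q"
    unfolding discrepancy_def using r' by (intro Max_ge) auto
  finally show ?thesis .
qed

lemma discrepancy_nonneg: "q \<ge> 1 \<Longrightarrow> T \<ge> 0 \<Longrightarrow> discrepancy f T q \<ge> 0"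
  by (rule order_trans[OF norm_ge_zero norm_sum_le_discrepancy[where v = 0 and r = 0]]) auto

text \<open>The discrepancy controls sums that start at \<open>-T\<close>; a sum over an interval is a difference of two of them.\<close>

lemma norm_sum_progression_le_discrepancy:
  fixes lo hi r :: int and T :: real
  assumes "q \<ge> 1" "-T \<le> of_int lo" "of_int hi \<le> T" "lo \<le> hi"
  shows "norm (\<Sum>n\<in>{n. lo \<le> n \<and> n \<le> hi \<and> [n = r] (mod int q)}. f n) \<le> 2 * discrepancy f T q"
proof -
  let ?S = "\<lambda>v. {n :: int. -T \<le> of_int n \<and> of_int n \<le> (v :: real) \<and> [n = r] (mod int q)}"
  let ?lo = "of_int (lo - 1) :: real"
  have T: "\<bar>of_int hi\<bar> \<le> T" "T \<ge> 0" using assms by linarith+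
  have "{n. lo \<le> n \<and> n \<le> hi \<and> [n = r] (mod int q)} = ?S (of_int hi) - ?S ?lo"
    using assms(2) by (auto simp del: of_int_diff intro: order_trans)
  moreover have "?S ?lo \<subseteq> ?S (of_int hi)"
    using assms(4) by (auto simp del: of_int_diff)
  ultimately have "(\<Sum>n\<in>{n. lo \<le> n \<and> n \<le> hi \<and> [n = r] (mod int q)}. f n)
      = (\<Sum>n\<in>?S (of_int hi). f n) - (\<Sum>n\<in>?S ?lo. f n)"
    by (simp only: sum_diff finite_int_le_real)
  then have "norm (\<Sum>n\<in>{n. lo \<le> n \<and> n \<le> hi \<and> [n = r] (mod int q)}. f n)
      \<le> norm (\<Sum>n\<in>?S (of_int hi). f n) + norm (\<Sum>n\<in>?S ?lo. f n)"
    by (simp only: norm_triangle_ineq4)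
  also have "norm (\<Sum>n\<in>?S (of_int hi). f n) \<le> discrepancy f T q"
    using assms(1) T(1) by (rule norm_sum_le_discrepancy)
  also have "norm (\<Sum>n\<in>?S ?lo. f n) \<le> discrepancy f T q"
  proof (cases "-T \<le> ?lo")
    case True
    have "\<bar>?lo\<bar> \<le> T" using True assms by linarith
    with assms(1) show ?thesis by (rule norm_sum_le_discrepancy)
  next
    case False
  \<comment> \<open>For \<open>lo\<close> within \<open>1\<close> of the left end \<open>-T\<close> the second sum is empty.\<close>
    then have "?S ?lo = {}" by auto
    then show ?thesis using discrepancy_nonneg[OF assms(1) T(2)] by (simp only: sum.empty norm_zero)
  qed
  finally show ?thesis by simp
qed

lemma between_in_interval:
  fixes y w k K h :: int
  assumes "y \<in> {-h..h}" "y + w * K \<in> {-h..h}" "0 \<le> k \<and> k \<le> K \<or> K \<le> k \<and> k \<le> 0"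
  shows "y + w * k \<in> {-h..h}"
proof -
  have "0 \<le> w * k \<and> w * k \<le> w * K \<or> w * K \<le> w * k \<and> w * k \<le> 0"
    using assms(3) by (cases "w \<ge> 0") (auto simp: mult_le_cancel_left zero_le_mult_iff mult_le_0_iff)
  then show ?thesis using assms(1,2) by auto
qed

text \<open>On a line \<open>\<alpha> y + \<beta> z = u\<close> with coprime \<open>\<alpha>, \<beta>\<close> consecutive lattice points differ by \<open>(-\<beta>, \<alpha>)\<close>, which changes
\<open>a y + b z + e\<close> by \<open>\<delta> = \<alpha> b - a \<beta>\<close>. Since the box is convex, the values on the part of the line inside
the box are therefore exactly the members of a residue class modulo \<open>\<delta>\<close> between the smallest and the largest value,
each attained once.\<close>

lemma norm_sum_fibre_le_discrepancy:
  fixes \<alpha> \<beta> a b e u h :: int and T :: real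
  assumes "coprime \<alpha> \<beta>" and \<delta>: "\<alpha> * b - a * \<beta> \<noteq> 0"
    and bound: "\<And>y z. y \<in> {-h..h} \<Longrightarrow> z \<in> {-h..h} \<Longrightarrow> \<bar>real_of_int (a * y + b * z + e)\<bar> \<le> T"
    and "T \<ge> 0"
  shows "norm (\<Sum>p\<in>{p\<in>{-h..h} \<times> {-h..h}. \<alpha> * fst p + \<beta> * snd p = u}. f (a * fst p + b * snd p + e))
    \<le> 2 * discrepancy f T (nat \<bar>\<alpha> * b - a * \<beta>\<bar>)"
proof -
  define \<delta> where "\<delta> = \<alpha> * b - a * \<beta>"
  define S where "S = {p\<in>{-h..h} \<times> {-h..h}. \<alpha> * fst p + \<beta> * snd p = u}"
  define v where "v = (\<lambda>p. a * fst p + b * snd p + e)"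
  have \<delta>0: "\<delta> \<noteq> 0" using \<delta> by (simp add: \<delta>_def)
  have q: "nat \<bar>\<delta>\<bar> \<ge> 1" using \<delta>0 by simp
  have finS: "finite S" unfolding S_def by simp
  have diff: "\<delta> * (fst p - fst p') = - \<beta> * (v p - v p')" "\<delta> * (snd p - snd p') = \<alpha> * (v p - v p')"
    if "p \<in> S" "p' \<in> S" for p p'
  proof -
    have "\<alpha> * fst p + \<beta> * snd p = \<alpha> * fst p' + \<beta> * snd p'" using that by (simp add: S_def)
    then show "\<delta> * (fst p - fst p') = - \<beta> * (v p - v p')" "\<delta> * (snd p - snd p') = \<alpha> * (v p - v p')"
      unfolding \<delta>_def v_def by algebra+
  qed
  have inj: "inj_on v S"
  proof (rule inj_onI)
    fix p p' assume "p \<in> S" "p' \<in> S" "v p = v p'"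
    then have "\<delta> * (fst p - fst p') = 0" "\<delta> * (snd p - snd p') = 0" using diff by auto
    then show "p = p'" using \<delta>0 by (simp add: prod_eq_iff)
  qed
  have dvd: "\<delta> dvd v p - v p'" if "p \<in> S" "p' \<in> S" for p p'
  proof -
    have "\<delta> dvd - \<beta> * (v p - v p')" "\<delta> dvd \<alpha> * (v p - v p')"
      using diff[OF that] by (metis dvd_triv_left)+
    then have "\<delta> dvd gcd (\<beta> * (v p - v p')) (\<alpha> * (v p - v p'))" by simp
    also have "gcd (\<beta> * (v p - v p')) (\<alpha> * (v p - v p')) = \<bar>v p - v p'\<bar>"
      using assms(1) by (simp add: gcd_mult_right abs_mult coprime_commute gcd.commute)
    finally show ?thesis by simp
  qed
  have "norm (\<Sum>p\<in>S. f (v p)) \<le> 2 * discrepancy f T (nat \<bar>\<delta>\<bar>)"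
  proof (cases "S = {}")
    case True
    then show ?thesis using discrepancy_nonneg[OF q \<open>T \<ge> 0\<close>, of f] by simp
  next
    case False
    define lo where "lo = Min (v ` S)"
    define hi where "hi = Max (v ` S)"
    have "lo \<in> v ` S" "hi \<in> v ` S"
      unfolding lo_def hi_def using False finS by (intro Min_in Max_in; simp)+
    then obtain p1 p2 where p1: "p1 \<in> S" "lo = v p1" and p2: "p2 \<in> S" "hi = v p2" by blast
    have image: "v ` S = {n. lo \<le> n \<and> n \<le> hi \<and> [n = lo] (mod int (nat \<bar>\<delta>\<bar>))}" (is "_ = ?A")
    proof
      show "v ` S \<subseteq> ?A"
      proof
        fix n assume "n \<in> v ` S"
        then obtain p where p: "p \<in> S" "n = v p" by blast
        have "lo \<le> n" "n \<le> hi" unfolding lo_def hi_def using \<open>n \<in> v ` S\<close> finS by auto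
        moreover have "[n = lo] (mod int (nat \<bar>\<delta>\<bar>))"
          using dvd[OF p(1) p1(1)] by (simp add: cong_iff_dvd_diff p p1)
        ultimately show "n \<in> ?A" by blast
      qed
      show "?A \<subseteq> v ` S"
      proof
        fix n assume n: "n \<in> ?A"
        then have "\<delta> dvd n - lo" by (simp add: cong_iff_dvd_diff)
        then obtain k where k: "n - lo = \<delta> * k" by blast
        obtain K where K: "hi - lo = \<delta> * K" using dvd[OF p2(1) p1(1)] p1 p2 by blast
        have "\<delta> * (fst p2 - fst p1) = \<delta> * (- \<beta> * K)" "\<delta> * (snd p2 - snd p1) = \<delta> * (\<alpha> * K)"
          using diff[OF p2(1) p1(1)] K by (simp_all add: p1(2) p2(2))
        then have "fst p2 - fst p1 = - \<beta> * K" "snd p2 - snd p1 = \<alpha> * K"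
          using \<delta>0 mult_left_cancel by blast+
        then have K': "fst p2 = fst p1 + (- \<beta>) * K" "snd p2 = snd p1 + \<alpha> * K" by auto
        have "0 \<le> \<delta> * k" "\<delta> * k \<le> \<delta> * K" using n k K by auto
        then have kK: "0 \<le> k \<and> k \<le> K \<or> K \<le> k \<and> k \<le> 0"
          using \<delta>0 by (cases "\<delta> > 0") (auto simp: zero_le_mult_iff mult_le_cancel_left)
        have "fst p1 \<in> {-h..h}" "fst p2 \<in> {-h..h}" "snd p1 \<in> {-h..h}" "snd p2 \<in> {-h..h}"
          using p1(1) p2(1) by (auto simp: S_def)
        then have "fst p1 + (- \<beta>) * k \<in> {-h..h}" "snd p1 + \<alpha> * k \<in> {-h..h}"
          unfolding K' using between_in_interval kK by blast+
        moreover have "\<alpha> * (fst p1 + (- \<beta>) * k) + \<beta> * (snd p1 + \<alpha> * k) = u"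
          using p1(1) by (simp add: S_def algebra_simps)
        moreover have "v (fst p1 + (- \<beta>) * k, snd p1 + \<alpha> * k) = n"
        proof -
          have "v (fst p1 + (- \<beta>) * k, snd p1 + \<alpha> * k) = v p1 + \<delta> * k"
            by (simp add: v_def \<delta>_def algebra_simps)
          then show ?thesis using k p1(2) by simp
        qed
        ultimately show "n \<in> v ` S" unfolding S_def
          by (intro image_eqI[of _ _ "(fst p1 + (- \<beta>) * k, snd p1 + \<alpha> * k)"]) auto
      qed
    qed
    have vT: "\<bar>real_of_int (v p)\<bar> \<le> T" if "p \<in> S" for p
      using bound[of "fst p" "snd p"] that by (auto simp: S_def v_def)
    have "lo \<le> hi" using p2 finS by (simp add: lo_def)
    have "(\<Sum>p\<in>S. f (v p)) = (\<Sum>n\<in>{n. lo \<le> n \<and> n \<le> hi \<and> [n = lo] (mod int (nat \<bar>\<delta>\<bar>))}. f n)"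
      using sum.reindex[OF inj, of f] image by (simp only: o_def)
    moreover have "-T \<le> of_int lo" "of_int hi \<le> T"
      using vT[OF p1(1)] vT[OF p2(1)] by (simp_all only: p1(2) p2(2) abs_le_iff minus_le_iff)
    ultimately show ?thesis
      using norm_sum_progression_le_discrepancy[OF q _ _ \<open>lo \<le> hi\<close>, where r = lo and f = f] by simp
  qed
  then show ?thesis by (simp only: S_def v_def \<delta>_def)
qed

text \<open>Dividing the first linear form by \<open>gcd a b\<close> makes its coefficients coprime. The fibres of the divided form
\<open>w\<close> are summed with the preceding lemma, and distinct \<open>w\<close> give distinct values
\<open>u\<close> of the first form, all of them bounded by \<open>T\<close>.\<close>

lemma bilinear_sum_le_discrepancy:
  fixes a b e a' b' e' h :: int and T :: real
  assumes D: "a * b' - a' * b \<noteq> 0"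
    and bound: "\<And>y z. y \<in> {-h..h} \<Longrightarrow> z \<in> {-h..h} \<Longrightarrow> \<bar>real_of_int (a * y + b * z + e)\<bar> \<le> T"
    and bound': "\<And>y z. y \<in> {-h..h} \<Longrightarrow> z \<in> {-h..h} \<Longrightarrow> \<bar>real_of_int (a' * y + b' * z + e')\<bar> \<le> T"
    and "T \<ge> 0"
  shows "norm (\<Sum>y\<in>{-h..h}. \<Sum>z\<in>{-h..h}. f (a * y + b * z + e) * cnj (f (a' * y + b' * z + e')))
    \<le> 2 * discrepancy f T (nat (\<bar>a * b' - a' * b\<bar> div gcd a b)) * (\<Sum>u\<in>{-\<lfloor>T\<rfloor>..\<lfloor>T\<rfloor>}. norm (f u))"
proof -
  define g where "g = gcd a b"
  have g: "g > 0" unfolding g_def using D by auto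
  obtain \<alpha> \<beta> where \<alpha>\<beta>: "a = g * \<alpha>" "b = g * \<beta>" "coprime \<alpha> \<beta>"
    using g gcd_coprime_exists[of a b] unfolding g_def by (metis gcd_eq_0_iff less_irrefl mult.commute)
  define q where "q = nat \<bar>\<alpha> * b' - a' * \<beta>\<bar>"
  have Dq: "a * b' - a' * b = g * (\<alpha> * b' - a' * \<beta>)" by (simp add: \<alpha>\<beta> algebra_simps)
  then have q: "nat (\<bar>a * b' - a' * b\<bar> div gcd a b) = q"
    using g by (simp add: q_def abs_mult flip: g_def)
  have \<delta>: "\<alpha> * b' - a' * \<beta> \<noteq> 0" using Dq D by auto
  let ?P = "{-h..h} \<times> {-h..h}"
  let ?w = "\<lambda>p. \<alpha> * fst p + \<beta> * snd p" and ?v = "\<lambda>p. a' * fst p + b' * snd p + e'"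
  have ab: "a * y + b * z + e = g * (\<alpha> * y + \<beta> * z) + e" for y z by (simp add: \<alpha>\<beta> algebra_simps)
  have "(\<Sum>y\<in>{-h..h}. \<Sum>z\<in>{-h..h}. f (a * y + b * z + e) * cnj (f (a' * y + b' * z + e')))
      = (\<Sum>p\<in>?P. f (g * ?w p + e) * cnj (f (?v p)))"
    unfolding ab sum.cartesian_product by (simp only: case_prod_unfold)
  also have "\<dots> = (\<Sum>w\<in>?w ` ?P. \<Sum>p\<in>{p\<in>?P. ?w p = w}. f (g * ?w p + e) * cnj (f (?v p)))"
    by (rule sum.image_gen) simp
  also have "\<dots> = (\<Sum>w\<in>?w ` ?P. f (g * w + e) * cnj (\<Sum>p\<in>{p\<in>?P. ?w p = w}. f (?v p)))"
    by (intro sum.cong refl) (simp add: sum_distrib_left)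
  finally have "norm (\<Sum>y\<in>{-h..h}. \<Sum>z\<in>{-h..h}. f (a * y + b * z + e) * cnj (f (a' * y + b' * z + e')))
      \<le> (\<Sum>w\<in>?w ` ?P. norm (f (g * w + e) * cnj (\<Sum>p\<in>{p\<in>?P. ?w p = w}. f (?v p))))"
    by (simp only: norm_sum)
  also have "\<dots> \<le> (\<Sum>w\<in>?w ` ?P. norm (f (g * w + e)) * (2 * discrepancy f T q))"
    unfolding norm_mult complex_mod_cnj q_def
    by (intro sum_mono mult_left_mono norm_sum_fibre_le_discrepancy \<alpha>\<beta> \<delta> bound' assms) auto
  also have "\<dots> = 2 * discrepancy f T q * (\<Sum>w\<in>?w ` ?P. norm (f (g * w + e)))"
    by (simp add: sum_distrib_left mult.commute)
  also have "(\<Sum>w\<in>?w ` ?P. norm (f (g * w + e))) = (\<Sum>u\<in>(\<lambda>w. g * w + e) ` ?w ` ?P. norm (f u))"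
    using g by (subst sum.reindex) (auto simp: inj_on_def)
  also have "2 * discrepancy f T q * \<dots> \<le> 2 * discrepancy f T q * (\<Sum>u\<in>{-\<lfloor>T\<rfloor>..\<lfloor>T\<rfloor>}. norm (f u))"
  proof (intro mult_left_mono sum_mono2)
    show "(\<lambda>w. g * w + e) ` ?w ` ?P \<subseteq> {-\<lfloor>T\<rfloor>..\<lfloor>T\<rfloor>}"
    proof
      fix u assume "u \<in> (\<lambda>w. g * w + e) ` ?w ` ?P"
      then obtain y z where yz: "y \<in> {-h..h}" "z \<in> {-h..h}" "u = g * (\<alpha> * y + \<beta> * z) + e" by auto
      then have "\<bar>real_of_int u\<bar> \<le> T" using bound[OF yz(1,2)] by (simp only: ab)
      then have "u \<le> \<lfloor>T\<rfloor>" "- u \<le> \<lfloor>T\<rfloor>" unfolding le_floor_iff by auto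
      then show "u \<in> {-\<lfloor>T\<rfloor>..\<lfloor>T\<rfloor>}" by auto
    qed
    show "0 \<le> 2 * discrepancy f T q"
      using discrepancy_nonneg[where q = q and T = T and f = f] \<delta> \<open>T \<ge> 0\<close> by (simp add: q_def)
  qed auto
  finally show ?thesis unfolding q .
qed

section \<open>Binary forms as coefficient vectors\<close>

definition form_value :: "nat \<Rightarrow> (nat \<Rightarrow> int) \<Rightarrow> int \<times> int \<Rightarrow> int" where
  "form_value d c n = (\<Sum>j=0..d. c j * (fst n ^ j * snd n ^ (d - j)))"

text \<open>The index set is a parameter so that single coefficients can be split off.\<close>

definition coeff_vectors :: "nat set \<Rightarrow> real \<Rightarrow> (nat \<Rightarrow> int) set" where
  "coeff_vectors I H = (\<Pi>\<^sub>E j\<in>I. {-\<lfloor>H\<rfloor>..\<lfloor>H\<rfloor>})"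

definition form_of :: "nat \<Rightarrow> (nat \<Rightarrow> int) \<Rightarrow> int poly poly" where
  "form_of d c = (\<Sum>j=0..d. monom (monom (c j) j) (d - j))"

lemma coeff_form_of:
  "coeff (coeff (form_of d c) i) j = (if i \<le> d \<and> j = d - i then c j else 0)"
proof -
  have "coeff (coeff (form_of d c) i) j
      = (\<Sum>k=0..d. if k = j then (if d - j = i then c j else 0) else 0)"
    unfolding form_of_def coeff_sum by (intro sum.cong refl) (auto simp: coeff_sum)
  also have "\<dots> = (if i \<le> d \<and> j = d - i then c j else 0)"
    by (subst sum.delta) auto
  finally show ?thesis .
qed

lemma eval2_form_of: "eval2 (form_of d c) = form_value d c"
  by (rule ext) (simp add: eval2_def form_of_def form_value_def poly_sum poly_monom mult.assoc poly_power
      flip: poly_const_pow)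

lemma finite_coeff_vectors: "finite I \<Longrightarrow> finite (coeff_vectors I H)"
  unfolding coeff_vectors_def by (intro finite_PiE) auto

lemma abs_le_iff_floor_interval: "\<bar>real_of_int c\<bar> \<le> H \<longleftrightarrow> c \<in> {-\<lfloor>H\<rfloor>..\<lfloor>H\<rfloor>}"
proof -
  have "\<bar>real_of_int c\<bar> \<le> H \<longleftrightarrow> c \<le> \<lfloor>H\<rfloor> \<and> - c \<le> \<lfloor>H\<rfloor>"
    unfolding le_floor_iff by auto
  then show ?thesis by auto
qed

lemma binary_forms_upto_eq:
  assumes "H \<ge> 0"
  shows "binary_forms_upto d H = form_of d ` coeff_vectors {0..d} H"
proof
  show "binary_forms_upto d H \<subseteq> form_of d ` coeff_vectors {0..d} H"
  proof
    fix F assume F: "F \<in> binary_forms_upto d H"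
    then obtain c where c: "F = form_of d c"
      by (auto simp: binary_forms_upto_def is_binary_form_def form_of_def)
    have "restrict c {0..d} \<in> coeff_vectors {0..d} H"
      unfolding coeff_vectors_def
    proof (rule restrict_PiE_iff[THEN iffD2], rule ballI)
      fix j assume j: "j \<in> {0..d}"
      have "coeff (coeff F (d - j)) j = c j" using j by (simp add: c coeff_form_of)
      then have "\<bar>real_of_int (c j)\<bar> \<le> H"
        using F unfolding binary_forms_upto_def by (metis (mono_tags, lifting) mem_Collect_eq)
      then show "c j \<in> {-\<lfloor>H\<rfloor>..\<lfloor>H\<rfloor>}" by (simp only: abs_le_iff_floor_interval)
    qed
    moreover have "F = form_of d (restrict c {0..d})"
      unfolding c form_of_def by (intro sum.cong) auto
    ultimately show "F \<in> form_of d ` coeff_vectors {0..d} H" by blast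
  qed
  show "form_of d ` coeff_vectors {0..d} H \<subseteq> binary_forms_upto d H"
  proof
    fix F assume "F \<in> form_of d ` coeff_vectors {0..d} H"
    then obtain c where c: "c \<in> coeff_vectors {0..d} H" "F = form_of d c" by blast
    have "\<bar>real_of_int (coeff (coeff F i) j)\<bar> \<le> H" for i j
    proof (cases "i \<le> d \<and> j = d - i")
      case True
      then have "j \<in> {0..d}" by auto
      then have "c j \<in> {-\<lfloor>H\<rfloor>..\<lfloor>H\<rfloor>}" using PiE_mem[OF c(1)[unfolded coeff_vectors_def]] by blast
      then show ?thesis using True by (simp only: abs_le_iff_floor_interval c coeff_form_of) simp
    next
      case False
      then show ?thesis using assms by (auto simp: c coeff_form_of)
    qed
    moreover have "is_binary_form d F" unfolding is_binary_form_def c form_of_def by blast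
    ultimately show "F \<in> binary_forms_upto d H" unfolding binary_forms_upto_def by blast
  qed
qed

lemma inj_on_form_of: "inj_on (form_of d) (coeff_vectors {0..d} H)"
proof (rule inj_onI)
  fix c c' assume c: "c \<in> coeff_vectors {0..d} H" "c' \<in> coeff_vectors {0..d} H"
    and eq: "form_of d c = form_of d c'"
  have "c j = c' j" if "j \<in> {0..d}" for j
    using arg_cong[OF eq, of "\<lambda>F. coeff (coeff F (d - j)) j"] that by (simp add: coeff_form_of)
  with c show "c = c'" unfolding coeff_vectors_def by (rule PiE_ext)
qed

lemma sum_binary_forms_upto:
  assumes "H \<ge> 0"
  shows "(\<Sum>F\<in>binary_forms_upto d H. G (eval2 F)) = (\<Sum>c\<in>coeff_vectors {0..d} H. G (form_value d c))"
  unfolding binary_forms_upto_eq[OF assms] sum.reindex[OF inj_on_form_of] o_def eval2_form_of ..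

lemma sum_coeff_vectors_insert:
  assumes "i \<notin> I"
  shows "(\<Sum>c\<in>coeff_vectors (insert i I) H. G c)
    = (\<Sum>c\<in>coeff_vectors I H. \<Sum>y\<in>{-\<lfloor>H\<rfloor>..\<lfloor>H\<rfloor>}. G (c(i := y)))"
proof -
  have "(\<Sum>c\<in>coeff_vectors (insert i I) H. G c)
      = (\<Sum>(y, c)\<in>{-\<lfloor>H\<rfloor>..\<lfloor>H\<rfloor>} \<times> coeff_vectors I H. G (c(i := y)))"
    unfolding coeff_vectors_def PiE_insert_eq
    by (subst sum.reindex[OF inj_combinator[OF assms]]) (simp add: case_prod_unfold o_def)
  also have "\<dots> = (\<Sum>y\<in>{-\<lfloor>H\<rfloor>..\<lfloor>H\<rfloor>}. \<Sum>c\<in>coeff_vectors I H. G (c(i := y)))"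
    by (rule sum.cartesian_product[symmetric])
  also have "\<dots> = (\<Sum>c\<in>coeff_vectors I H. \<Sum>y\<in>{-\<lfloor>H\<rfloor>..\<lfloor>H\<rfloor>}. G (c(i := y)))"
    by (rule sum.swap)
  finally show ?thesis .
qed

lemma card_floor_interval_le: "Y \<ge> 1 \<Longrightarrow> real (card {-\<lfloor>Y\<rfloor>..\<lfloor>Y\<rfloor>}) \<le> 3 * Y"
proof -
  assume Y: "Y \<ge> 1"
  then have "\<lfloor>Y\<rfloor> \<ge> 0" by simp
  then have "real (card {-\<lfloor>Y\<rfloor>..\<lfloor>Y\<rfloor>}) = 2 * real_of_int \<lfloor>Y\<rfloor> + 1" by simp
  then show ?thesis using Y of_int_floor_le[of Y] by linarith
qed

lemma card_coeff_vectors_le: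
  assumes "finite I" "H \<ge> 1"
  shows "real (card (coeff_vectors I H)) \<le> (3 * H) ^ card I"
proof -
  have "real (card (coeff_vectors I H)) = real (card {-\<lfloor>H\<rfloor>..\<lfloor>H\<rfloor>}) ^ card I"
    using assms by (simp add: coeff_vectors_def card_PiE del: card_atLeastAtMost_int)
  also have "\<dots> \<le> (3 * H) ^ card I"
    using assms by (intro power_mono card_floor_interval_le) auto
  finally show ?thesis .
qed

lemma form_value_bound:
  fixes x H :: real
  assumes c: "\<And>j. j \<in> {0..d} \<Longrightarrow> c j \<in> {-\<lfloor>H\<rfloor>..\<lfloor>H\<rfloor>}" and n: "n \<in> int_box x" and "H \<ge> 0"
  shows "\<bar>real_of_int (form_value d c n)\<bar> \<le> (1 + real d) * x ^ d * H"
proof -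
  have n': "\<bar>real_of_int (fst n)\<bar> \<le> x" "\<bar>real_of_int (snd n)\<bar> \<le> x"
    using n by (auto simp: int_box_def)
  then have x: "x \<ge> 0" by linarith
  have "\<bar>real_of_int (form_value d c n)\<bar> \<le> (\<Sum>j=0..d. \<bar>real_of_int (c j * (fst n ^ j * snd n ^ (d - j)))\<bar>)"
    unfolding form_value_def of_int_sum by (rule sum_abs)
  also have "\<dots> \<le> (\<Sum>j=0..d. H * x ^ d)"
  proof (rule sum_mono)
    fix j assume j: "j \<in> {0..d}"
    have "\<bar>real_of_int (c j * (fst n ^ j * snd n ^ (d - j)))\<bar>
        = \<bar>real_of_int (c j)\<bar> * (\<bar>real_of_int (fst n)\<bar> ^ j * \<bar>real_of_int (snd n)\<bar> ^ (d - j))"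
      by (simp add: abs_mult power_abs)
    also have "\<dots> \<le> H * (x ^ j * x ^ (d - j))"
      using n' x \<open>H \<ge> 0\<close> c[OF j] by (intro mult_mono power_mono) (auto simp: abs_le_iff_floor_interval simp del: atLeastAtMost_iff)
    also have "x ^ j * x ^ (d - j) = x ^ d" using j by (simp flip: power_add)
    finally show "\<bar>real_of_int (c j * (fst n ^ j * snd n ^ (d - j)))\<bar> \<le> H * x ^ d" .
  qed
  also have "\<dots> = (1 + real d) * x ^ d * H" by simp
  finally show ?thesis .
qed

text \<open>All values of the forms are bounded by a fixed power of the length \<open>H\<close> of the range of one coefficient, as
the divisor moments along progressions require.\<close>

lemma form_range_le_power:
  fixes x H :: real
  assumes "H \<ge> 3" "1 \<le> x" "x \<le> H"
  shows "(1 + real d) * x ^ d * H \<le> H ^ (2 * d + 1)"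
proof -
  have "1 + real d \<le> 3 ^ d"
  proof (induction d)
    case (Suc d)
    then show ?case using one_le_power[of "3::real" d] by simp
  qed simp
  also have "\<dots> \<le> H ^ d" using assms by (intro power_mono) auto
  finally have "(1 + real d) * x ^ d * H \<le> H ^ d * H ^ d * H"
    using assms by (intro mult_mono power_mono mult_nonneg_nonneg) auto
  also have "\<dots> = H ^ (2 * d + 1)" by (simp add: power_add mult_2)
  finally show ?thesis .
qed

lemma form_value_upd:
  assumes "i \<le> d"
  shows "form_value d (c(i := y)) n
    = (fst n ^ i * snd n ^ (d - i)) * y + (\<Sum>j\<in>{0..d} - {i}. c j * (fst n ^ j * snd n ^ (d - j)))"
proof -
  have "form_value d (c(i := y)) n = (c(i := y)) i * (fst n ^ i * snd n ^ (d - i))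
      + (\<Sum>j\<in>{0..d} - {i}. (c(i := y)) j * (fst n ^ j * snd n ^ (d - j)))"
    unfolding form_value_def using assms by (intro sum.remove) auto
  also have "(\<Sum>j\<in>{0..d} - {i}. (c(i := y)) j * (fst n ^ j * snd n ^ (d - j)))
      = (\<Sum>j\<in>{0..d} - {i}. c j * (fst n ^ j * snd n ^ (d - j)))"
    by (intro sum.cong) auto
  finally show ?thesis by (simp only: fun_upd_same mult.commute)
qed

section \<open>Moments at a fixed point\<close>

text \<open>For \<open>n \<noteq> (0, 0)\<close> one of the two end coefficients \<open>c\<^sub>d, c\<^sub>0\<close> is multiplied by a nonzero number \<open>a = n\<^sub>1\<^sup>d\<close> or
\<open>a = n\<^sub>2\<^sup>d\<close>. With the other coefficients frozen the form runs through a progression of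
difference \<open>a\<close>, and the power of \<open>\<tau> a\<close> is at most a constant times \<open>x\<^sup>1\<^sup>/\<^sup>4\<close> because \<open>\<bar>a\<bar> \<le> x\<^sup>d\<close>.\<close>

lemma form_moment:
  assumes "d \<ge> 1"
  shows "\<exists>K>0. \<forall>H x n. H \<ge> 3 \<longrightarrow> 1 \<le> x \<longrightarrow> x \<le> H \<longrightarrow> n \<in> int_box x \<longrightarrow>
    (\<Sum>c\<in>coeff_vectors {0..d} H. real (tau_weight (form_value d c n)) ^ R)
      \<le> K * H ^ (d + 1) * ln H ^ (2 ^ (R * (2 * d + 1))) * x powr (1 / 4)"
proof -
  define k where "k = R * (2 * d + 1)"
  obtain K0 :: real where K0: "K0 \<ge> 1"
      "\<And>n. n \<ge> 1 \<Longrightarrow> real (divisor_tau n) ^ Suc k \<le> K0 * real n powr (1 / (4 * real d))"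
    using divisor_tau_power_bound[of "1 / (4 * real d)" "Suc k"] assms by auto
  define K where "K = 3 ^ (d + 1) * 4 * 2 ^ k * K0 * 2 ^ 2 ^ k"
  have "(\<Sum>c\<in>coeff_vectors {0..d} H. real (tau_weight (form_value d c n)) ^ R)
      \<le> K * H ^ (d + 1) * ln H ^ (2 ^ k) * x powr (1 / 4)"
    if H: "H \<ge> 3" "1 \<le> x" "x \<le> H" and n: "n \<in> int_box x" for H x :: real and n
  proof -
    have lnH: "ln H \<ge> 1" using H ln_ge_iff[of H 1] exp_le by linarith
    have x14: "x powr (1 / 4) \<ge> 1" using H by (intro ge_one_powr_ge_zero) auto
    have big: "1 \<le> 4 * 2 ^ k * K0 * 2 ^ 2 ^ k * (ln H ^ (2 ^ k) * x powr (1 / 4))"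
    proof -
      have "1 * 1 * 1 * 1 * (1 * 1) \<le> 4 * 2 ^ k * K0 * 2 ^ 2 ^ k * (ln H ^ (2 ^ k) * x powr (1 / 4))"
        using K0 lnH x14 by (intro mult_mono one_le_power) auto
      then show ?thesis by simp
    qed
    show ?thesis
    proof (cases "n = (0, 0)")
      case True
      have "form_value d c n = 0" for c
        unfolding form_value_def True using assms by (intro sum.neutral) (auto simp: power_0_left)
      then have "(\<Sum>c\<in>coeff_vectors {0..d} H. real (tau_weight (form_value d c n)) ^ R)
          = real (card (coeff_vectors {0..d} H))"
        by (simp add: tau_weight_def divisor_tau_def)
      also have "\<dots> \<le> (3 * H) ^ (d + 1)"
        using card_coeff_vectors_le[of "{0..d}" H] H by simp
      also have "\<dots> \<le> (3 * H) ^ (d + 1) * (4 * 2 ^ k * K0 * 2 ^ 2 ^ k * (ln H ^ (2 ^ k) * x powr (1 / 4)))"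
        using big H mult_left_mono[OF big, of "(3 * H) ^ (d + 1)"] by simp
      finally show ?thesis by (simp add: K_def power_mult_distrib mult_ac)
    next
      case False
      obtain i where i: "i \<le> d" "i = d \<and> fst n \<noteq> 0 \<or> i = 0 \<and> snd n \<noteq> 0"
        using False by (metis le_refl prod.collapse zero_le)
      define a where "a = fst n ^ i * snd n ^ (d - i)"
      have a0: "a \<noteq> 0" using i by (auto simp: a_def)
      have "\<bar>real_of_int (fst n)\<bar> \<le> x" "\<bar>real_of_int (snd n)\<bar> \<le> x"
        using n by (auto simp: int_box_def)
      then have "\<bar>real_of_int a\<bar> \<le> x ^ d"
        using i by (auto simp: a_def power_abs intro!: power_mono simp del: power_mono_iff)
      then have a_le: "real (nat \<bar>a\<bar>) \<le> x powr real d" using H by (simp add: powr_realpow)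
      have "real (divisor_tau (nat \<bar>a\<bar>)) ^ Suc k \<le> K0 * real (nat \<bar>a\<bar>) powr (1 / (4 * real d))"
        using a0 by (intro K0) auto
      also have "\<dots> \<le> K0 * (x powr real d) powr (1 / (4 * real d))"
        using a_le K0 by (intro mult_left_mono powr_mono2) auto
      also have "\<dots> = K0 * x powr (1 / 4)" using assms by (simp add: powr_powr)
      finally have tau_a: "real (divisor_tau (nat \<bar>a\<bar>)) ^ Suc k \<le> K0 * x powr (1 / 4)" .
      let ?J = "{0..d} - {i}"
      have insert: "insert i ?J = {0..d}" using i by auto
      have inner: "(\<Sum>y\<in>{-\<lfloor>H\<rfloor>..\<lfloor>H\<rfloor>}. real (tau_weight (form_value d (c(i := y)) n)) ^ R)
          \<le> 4 * 2 ^ k * H * (K0 * x powr (1 / 4)) * (2 * ln H) ^ (2 ^ k)" if c: "c \<in> coeff_vectors ?J H" for c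
      proof -
        define b where "b = (\<Sum>j\<in>?J. c j * (fst n ^ j * snd n ^ (d - j)))"
        have eq: "form_value d (c(i := y)) n = a * y + b" for y
          using form_value_upd[of i d] i by (simp add: a_def b_def)
        have "(\<Sum>y\<in>{-\<lfloor>H\<rfloor>..\<lfloor>H\<rfloor>}. real (tau_weight (a * y + b)) ^ R)
          \<le> 4 * 2 ^ (R * (2 * d + 1)) * H * real (divisor_tau (nat \<bar>a\<bar>)) ^ Suc (R * (2 * d + 1))
              * (1 + ln H) ^ (2 ^ (R * (2 * d + 1)))"
        proof (rule tau_weight_moment_progression)
          fix y assume y: "y \<in> {-\<lfloor>H\<rfloor>..\<lfloor>H\<rfloor>}"
          have "(c(i := y)) j \<in> {-\<lfloor>H\<rfloor>..\<lfloor>H\<rfloor>}" if "j \<in> {0..d}" for j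
            using that c y by (cases "j = i") (auto simp: coeff_vectors_def Pi_iff PiE_def)
          then have "\<bar>real_of_int (form_value d (c(i := y)) n)\<bar> \<le> (1 + real d) * x ^ d * H"
            using n H by (intro form_value_bound) auto
          also have "\<dots> \<le> H ^ (2 * d + 1)" by (rule form_range_le_power) fact+
          finally show "\<bar>real_of_int (a * y + b)\<bar> \<le> H ^ (2 * d + 1)" by (simp only: eq)
        qed (use H a0 in auto)
        also have "\<dots> \<le> 4 * 2 ^ k * H * (K0 * x powr (1 / 4)) * (2 * ln H) ^ (2 ^ k)"
          using H lnH tau_a K0(1) unfolding k_def[symmetric]
          by (intro mult_mono power_mono) (auto intro!: mult_nonneg_nonneg)
        finally show ?thesis by (simp only: eq)
      qed
      have "(\<Sum>c\<in>coeff_vectors {0..d} H. real (tau_weight (form_value d c n)) ^ R)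
          = (\<Sum>c\<in>coeff_vectors ?J H. \<Sum>y\<in>{-\<lfloor>H\<rfloor>..\<lfloor>H\<rfloor>}. real (tau_weight (form_value d (c(i := y)) n)) ^ R)"
        by (subst insert[symmetric], rule sum_coeff_vectors_insert) simp
      also have "\<dots> \<le> (\<Sum>c\<in>coeff_vectors ?J H. 4 * 2 ^ k * H * (K0 * x powr (1 / 4)) * (2 * ln H) ^ (2 ^ k))"
        by (intro sum_mono inner)
      also have "\<dots> = real (card (coeff_vectors ?J H)) * (4 * 2 ^ k * H * (K0 * x powr (1 / 4)) * (2 * ln H) ^ (2 ^ k))"
        by simp
      also have "\<dots> \<le> (3 * H) ^ d * (4 * 2 ^ k * H * (K0 * x powr (1 / 4)) * (2 * ln H) ^ (2 ^ k))"
        using card_coeff_vectors_le[of ?J H] i H lnH K0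
        by (intro mult_right_mono) auto
      also have "\<dots> \<le> K * H ^ (d + 1) * ln H ^ (2 ^ k) * x powr (1 / 4)"
      proof -
        have "(3 * H) ^ d * (4 * 2 ^ k * H * (K0 * x powr (1 / 4)) * (2 * ln H) ^ (2 ^ k))
            = (3 ^ d * 4 * 2 ^ k * K0 * 2 ^ 2 ^ k) * (H ^ (d + 1) * ln H ^ (2 ^ k) * x powr (1 / 4))"
          by (simp add: power_mult_distrib mult_ac)
        also have "\<dots> \<le> K * (H ^ (d + 1) * ln H ^ (2 ^ k) * x powr (1 / 4))"
          using H lnH K0 by (intro mult_right_mono) (auto simp: K_def)
        finally show ?thesis by (simp only: mult.assoc)
      qed
      finally show ?thesis .
    qed
  qed
  moreover have "K > 0" using K0 by (simp add: K_def)
  ultimately show ?thesis unfolding k_def by blast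
qed

section \<open>Correlations at pairs of points\<close>

lemma int_box_eq: "int_box x = {-\<lfloor>x\<rfloor>..\<lfloor>x\<rfloor>} \<times> {-\<lfloor>x\<rfloor>..\<lfloor>x\<rfloor>}"
proof -
  have "real_of_int a \<in> {-x..x} \<longleftrightarrow> a \<in> {-\<lfloor>x\<rfloor>..\<lfloor>x\<rfloor>}" for a
    unfolding abs_le_iff_floor_interval[symmetric] by auto
  then show ?thesis
    unfolding int_box_def by (simp only: set_eq_iff mem_Collect_eq mem_Times_iff)
      blast
qed

lemma finite_int_box: "finite (int_box x)"
  by (simp add: int_box_eq)

text \<open>A vanishing determinant means \<open>\<bar>m\<^sub>1 n\<^sub>2\<bar> = \<bar>n\<^sub>1 m\<^sub>2\<bar>\<close>. If \<open>m\<^sub>1 \<noteq> 0\<close>, then \<open>m\<close>, \<open>n\<^sub>1\<close> and the sign of \<open>n\<^sub>2\<close>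
determine \<open>n\<^sub>2\<close>; if \<open>m\<^sub>1 = 0\<close>, then \<open>m\<^sub>2 = 0\<close> or \<open>n\<^sub>1 = 0\<close>. So at most three of the four coordinates are free, up to the choice of a sign.\<close>

lemma card_degenerate_pairs:
  fixes x :: real
  assumes "x \<ge> 1" "d \<ge> 1"
  shows "real (card {p \<in> int_box x \<times> int_box x.
      fst (fst p) ^ d * snd (snd p) ^ d - fst (snd p) ^ d * snd (fst p) ^ d = 0}) \<le> 135 * x ^ 3"
proof -
  define I where "I = {-\<lfloor>x\<rfloor>..\<lfloor>x\<rfloor>}"
  let ?P = "{p \<in> int_box x \<times> int_box x. fst (fst p) ^ d * snd (snd p) ^ d - fst (snd p) ^ d * snd (fst p) ^ d = 0}"
  have P: "fst (fst p) \<in> I" "snd (fst p) \<in> I" "fst (snd p) \<in> I" "snd (snd p) \<in> I"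
      "\<bar>fst (fst p) * snd (snd p)\<bar> = \<bar>fst (snd p) * snd (fst p)\<bar>" if "p \<in> ?P" for p
  proof -
    have "(fst (fst p) * snd (snd p)) ^ d = (fst (snd p) * snd (fst p)) ^ d"
      using that by (simp add: power_mult_distrib)
    then have "\<bar>fst (fst p) * snd (snd p)\<bar> ^ d = \<bar>fst (snd p) * snd (fst p)\<bar> ^ d"
      by (simp only: power_abs[symmetric])
    then show "\<bar>fst (fst p) * snd (snd p)\<bar> = \<bar>fst (snd p) * snd (fst p)\<bar>"
      by (rule power_eq_imp_eq_base) (use assms(2) in simp_all)
  qed (use that in \<open>auto simp: int_box_eq I_def\<close>)
  let ?A = "(\<lambda>(s, t). ((0 :: int, 0 :: int), (s, t))) ` (I \<times> I)" and ?B = "(\<lambda>(s, t). ((0 :: int, s), (0 :: int, t))) ` (I \<times> I)"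
  let ?C = "{p \<in> ?P. fst (fst p) \<noteq> 0}"
  let ?code = "\<lambda>p :: (int \<times> int) \<times> (int \<times> int). (fst p, fst (snd p), sgn (snd (snd p)))"
  have "?P \<subseteq> ?A \<union> ?B \<union> ?C"
  proof
    fix p assume p: "p \<in> ?P"
    obtain a b s t where pe: "p = ((a, b), (s, t))" by (metis prod.collapse)
    show "p \<in> ?A \<union> ?B \<union> ?C"
    proof (cases "a = 0")
      case True
      then have "b = 0 \<or> s = 0" using P(5)[OF p] pe by auto
      then show ?thesis using True P(1-4)[OF p] pe by auto
    next
      case False
      then show ?thesis using p pe by auto
    qed
  qed
  moreover have fin: "finite (?A \<union> ?B \<union> ?C)"
    by (auto simp: I_def finite_int_box)
  ultimately have "card ?P \<le> card (?A \<union> ?B \<union> ?C)" by (rule card_mono[rotated])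
  also have "\<dots> \<le> card ?A + card ?B + card ?C"
    using card_Un_le[of "?A \<union> ?B" ?C] card_Un_le[of ?A ?B] by linarith
  also have "card ?A \<le> card I * card I"
    using card_image_le[of "I \<times> I" "\<lambda>(s, t). ((0 :: int, 0 :: int), (s, t))"]
    by (simp add: I_def card_cartesian_product)
  also have "card ?B \<le> card I * card I"
    using card_image_le[of "I \<times> I" "\<lambda>(s, t). ((0 :: int, s), (0 :: int, t))"]
    by (simp add: I_def card_cartesian_product)
  also have "card ?C \<le> card ((I \<times> I) \<times> I \<times> {-1, 0, 1 :: int})"
  proof (rule card_inj_on_le)
    show "inj_on ?code ?C"
    proof (rule inj_onI)
      fix p p' assume p: "p \<in> ?C" "p' \<in> ?C" and eq: "?code p = ?code p'"
      have "\<bar>fst (fst p)\<bar> * \<bar>snd (snd p)\<bar> = \<bar>fst (fst p)\<bar> * \<bar>snd (snd p')\<bar>"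
        using P(5)[of p] P(5)[of p'] p eq by (simp add: abs_mult)
      then have "\<bar>snd (snd p)\<bar> = \<bar>snd (snd p')\<bar>" using p by simp
      moreover have "sgn (snd (snd p)) = sgn (snd (snd p'))" using eq by simp
      ultimately have "snd (snd p) = snd (snd p')" by (metis sgn_mult_abs)
      then show "p = p'" using eq by (simp add: prod_eq_iff)
    qed
    show "?code ` ?C \<subseteq> (I \<times> I) \<times> I \<times> {-1, 0, 1 :: int}"
    proof
      fix w assume "w \<in> ?code ` ?C"
      then obtain p where p: "p \<in> ?C" "w = ?code p" by blast
      then have "p \<in> ?P" by blast
      from P(1-3)[OF this] show "w \<in> (I \<times> I) \<times> I \<times> {-1, 0, 1 :: int}"
        by (auto simp: p(2) sgn_if mem_Times_iff)
    qed
  qed (simp add: I_def)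
  also have "card ((I \<times> I) \<times> I \<times> {-1, 0, 1 :: int}) = 3 * card I ^ 3"
    by (simp add: card_cartesian_product power3_eq_cube)
  finally have "card ?P \<le> card I * card I + card I * card I + 3 * card I ^ 3" by simp
  moreover have "card I * card I \<le> card I ^ 3"
    by (cases "card I") (auto simp: power3_eq_cube)
  ultimately have "card ?P \<le> 5 * card I ^ 3" by linarith
  then have "real (card ?P) \<le> real (5 * card I ^ 3)" by (rule of_nat_mono)
  also have "\<dots> = 5 * real (card I) ^ 3" by simp
  also have "real (card I) ^ 3 \<le> (3 * x) ^ 3"
    using card_floor_interval_le[OF assms(1)] by (intro power_mono) (auto simp: I_def)
  finally show ?thesis by (simp add: power_mult_distrib)
qed

lemma sum_norm_square_le_pairs:
  assumes "finite S" "finite B"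
  shows "(\<Sum>c\<in>S. (norm (\<Sum>n\<in>B. Z c n :: complex))\<^sup>2)
    \<le> (\<Sum>p\<in>B \<times> B. norm (\<Sum>c\<in>S. Z c (fst p) * cnj (Z c (snd p))))"
proof -
  have "complex_of_real (\<Sum>c\<in>S. (norm (\<Sum>n\<in>B. Z c n))\<^sup>2)
      = (\<Sum>c\<in>S. (\<Sum>n\<in>B. Z c n) * cnj (\<Sum>n\<in>B. Z c n))"
    by (simp only: of_real_sum complex_norm_square)
  also have "\<dots> = (\<Sum>c\<in>S. \<Sum>p\<in>B \<times> B. Z c (fst p) * cnj (Z c (snd p)))"
    unfolding cnj_sum sum_product sum.cartesian_product case_prod_unfold ..
  also have "\<dots> = (\<Sum>p\<in>B \<times> B. \<Sum>c\<in>S. Z c (fst p) * cnj (Z c (snd p)))" by (rule sum.swap)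
  finally have eq: "complex_of_real (\<Sum>c\<in>S. (norm (\<Sum>n\<in>B. Z c n))\<^sup>2)
      = (\<Sum>p\<in>B \<times> B. \<Sum>c\<in>S. Z c (fst p) * cnj (Z c (snd p)))" .
  have "(\<Sum>c\<in>S. (norm (\<Sum>n\<in>B. Z c n))\<^sup>2) = norm (complex_of_real (\<Sum>c\<in>S. (norm (\<Sum>n\<in>B. Z c n))\<^sup>2))"
    by (simp only: norm_of_real abs_of_nonneg sum_nonneg zero_le_power2)
  also have "\<dots> \<le> (\<Sum>p\<in>B \<times> B. norm (\<Sum>c\<in>S. Z c (fst p) * cnj (Z c (snd p))))"
    unfolding eq by (rule norm_sum)
  finally show ?thesis .
qed

lemma correlation_le_second_moments:
  fixes z w :: "'a \<Rightarrow> complex"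
  assumes "(\<Sum>c\<in>S. (norm (z c))\<^sup>2) \<le> M" "(\<Sum>c\<in>S. (norm (w c))\<^sup>2) \<le> M"
  shows "norm (\<Sum>c\<in>S. z c * cnj (w c)) \<le> M"
proof -
  have "norm (\<Sum>c\<in>S. z c * cnj (w c)) \<le> (\<Sum>c\<in>S. norm (z c) * norm (w c))"
    by (rule order_trans[OF norm_sum]) (simp add: norm_mult)
  also have "\<dots> \<le> (\<Sum>c\<in>S. (norm (z c))\<^sup>2 / 2 + (norm (w c))\<^sup>2 / 2)"
  proof (rule sum_mono)
    fix c
    show "norm (z c) * norm (w c) \<le> (norm (z c))\<^sup>2 / 2 + (norm (w c))\<^sup>2 / 2"
      using sum_squares_bound[of "norm (z c)" "norm (w c)"] by simp
  qed
  also have "\<dots> = (\<Sum>c\<in>S. (norm (z c))\<^sup>2) / 2 + (\<Sum>c\<in>S. (norm (w c))\<^sup>2) / 2"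
    by (simp only: sum.distrib sum_divide_distrib)
  finally show ?thesis using assms by simp
qed

lemma form_value_end_coefficients:
  assumes "d \<ge> 1"
  shows "form_value d (c(d := y, 0 := z)) n
    = fst n ^ d * y + snd n ^ d * z + (\<Sum>j\<in>{1..<d}. c j * (fst n ^ j * snd n ^ (d - j)))"
proof -
  have set: "{0..d} = insert 0 (insert d {1..<d})" using assms by auto
  have "(\<Sum>j\<in>{1..<d}. (c(d := y, 0 := z)) j * (fst n ^ j * snd n ^ (d - j)))
      = (\<Sum>j\<in>{1..<d}. c j * (fst n ^ j * snd n ^ (d - j)))"
    by (intro sum.cong) auto
  then show ?thesis
    unfolding form_value_def set using assms by (simp add: mult.commute)
qed

text \<open>The two linear forms to which the bilinear estimate applies are \<open>F\<^sub>c m\<close> and \<open>F\<^sub>c n\<close> as functions of \<open>c\<^sub>d\<close> and \<open>c\<^sub>0\<close>;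
the \<open>d - 1\<close> inner coefficients only shift them.\<close>

lemma form_correlation_le_discrepancy:
  fixes x H :: real
  assumes d: "d \<ge> 1" and H: "H \<ge> 1" and x: "x \<ge> 1" and m: "m \<in> int_box x" and n: "n \<in> int_box x"
    and D: "fst m ^ d * snd n ^ d - fst n ^ d * snd m ^ d \<noteq> 0"
  defines "T \<equiv> (1 + real d) * x ^ d * H"
  shows "\<exists>q\<ge>1. real q \<le> 2 * x ^ (2 * d) \<and>
    norm (\<Sum>c\<in>coeff_vectors {0..d} H. f (form_value d c m) * cnj (f (form_value d c n)))
      \<le> (3 * H) ^ (d - 1) * (2 * discrepancy f T q * (\<Sum>u\<in>{-\<lfloor>T\<rfloor>..\<lfloor>T\<rfloor>}. norm (f u)))"
proof -
  define D where "D = fst m ^ d * snd n ^ d - fst n ^ d * snd m ^ d"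
  define q where "q = nat (\<bar>D\<bar> div gcd (fst m ^ d) (snd m ^ d))"
  define g where "g = gcd (fst m ^ d) (snd m ^ d)"
  have "g \<noteq> 0"
  proof
    assume "g = 0"
    then have "fst m ^ d = 0" "snd m ^ d = 0" unfolding g_def gcd_eq_0_iff by blast+
    then show False using D by (simp only: mult_zero_left mult_zero_right diff_self)
  qed
  then have g: "g > 0" unfolding g_def by (simp only: less_le gcd_ge_0_int) simp
  have "g dvd fst m ^ d" "g dvd snd m ^ d" unfolding g_def by (rule gcd_dvd1, rule gcd_dvd2)
  then have "g dvd D" unfolding D_def by (intro dvd_diff dvd_mult dvd_mult2)
  then obtain k where k: "\<bar>D\<bar> = g * k" by (metis dvd_abs_iff dvdE)
  have "\<bar>D\<bar> > 0" using D by (simp add: D_def)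
  then have k0: "k > 0" using g k by (simp add: zero_less_mult_iff)
  have qk: "int q = k" unfolding q_def g_def[symmetric] k using g k0 by simp
  have "k \<le> \<bar>D\<bar>" using k g k0 by simp
  then have "real q \<le> \<bar>real_of_int D\<bar>" using qk by linarith
  also have "\<dots> \<le> \<bar>real_of_int (fst m)\<bar> ^ d * \<bar>real_of_int (snd n)\<bar> ^ d + \<bar>real_of_int (fst n)\<bar> ^ d * \<bar>real_of_int (snd m)\<bar> ^ d"
    unfolding D_def by (simp flip: power_abs abs_mult add: abs_triangle_ineq4)
  also have "\<dots> \<le> x ^ d * x ^ d + x ^ d * x ^ d"
    using m n x by (intro add_mono mult_mono power_mono) (auto simp: int_box_def)
  also have "\<dots> = 2 * x ^ (2 * d)" by (simp add: mult_2[of d] power_add)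
  finally have q_le: "real q \<le> 2 * x ^ (2 * d)" .
  define W where "W = (\<Sum>u\<in>{-\<lfloor>T\<rfloor>..\<lfloor>T\<rfloor>}. norm (f u))"
  let ?J = "{1..<d}" and ?I = "{-\<lfloor>H\<rfloor>..\<lfloor>H\<rfloor>}"
  let ?e = "\<lambda>c n. \<Sum>j\<in>?J. c j * (fst n ^ j * snd n ^ (d - j))"
  have set: "{0..d} = insert 0 (insert d ?J)" using d by auto
  have bound: "\<bar>real_of_int (fst n ^ d * y + snd n ^ d * z + ?e c n)\<bar> \<le> T"
    if c: "c \<in> coeff_vectors ?J H" and yz: "y \<in> ?I" "z \<in> ?I" and n: "n \<in> int_box x" for c y z n
  proof -
    have "(c(d := y, 0 := z)) j \<in> ?I" if "j \<in> {0..d}" for j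
      using that c yz unfolding set coeff_vectors_def by (auto simp: PiE_def Pi_iff)
    then have "\<bar>real_of_int (form_value d (c(d := y, 0 := z)) n)\<bar> \<le> (1 + real d) * x ^ d * H"
      using n H by (intro form_value_bound) auto
    then show ?thesis by (simp only: form_value_end_coefficients[OF d] T_def)
  qed
  have T0: "T \<ge> 0" using x H by (simp add: T_def)
  have "(\<Sum>c\<in>coeff_vectors {0..d} H. f (form_value d c m) * cnj (f (form_value d c n)))
      = (\<Sum>c\<in>coeff_vectors ?J H. \<Sum>y\<in>?I. \<Sum>z\<in>?I.
          f (fst m ^ d * y + snd m ^ d * z + ?e c m) * cnj (f (fst n ^ d * y + snd n ^ d * z + ?e c n)))"
    unfolding set
    by (subst sum_coeff_vectors_insert, use d in simp, subst sum_coeff_vectors_insert, simp)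
      (simp only: form_value_end_coefficients[OF d])
  then have "norm (\<Sum>c\<in>coeff_vectors {0..d} H. f (form_value d c m) * cnj (f (form_value d c n)))
      \<le> (\<Sum>c\<in>coeff_vectors ?J H. norm (\<Sum>y\<in>?I. \<Sum>z\<in>?I.
          f (fst m ^ d * y + snd m ^ d * z + ?e c m) * cnj (f (fst n ^ d * y + snd n ^ d * z + ?e c n))))"
    by (simp only: norm_sum)
  also have "\<dots> \<le> (\<Sum>c\<in>coeff_vectors ?J H. 2 * discrepancy f T q * W)"
    unfolding q_def D_def W_def
    by (intro sum_mono bilinear_sum_le_discrepancy D bound m n T0)
  also have "\<dots> = real (card (coeff_vectors ?J H)) * (2 * discrepancy f T q * W)" by simp
  also have "\<dots> \<le> (3 * H) ^ (d - 1) * (2 * discrepancy f T q * W)"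
  proof (rule mult_right_mono)
    show "real (card (coeff_vectors ?J H)) \<le> (3 * H) ^ (d - 1)"
      using card_coeff_vectors_le[of ?J H] H by simp
    show "0 \<le> 2 * discrepancy f T q * W"
      using discrepancy_nonneg[of q T f] qk k0 T0 by (simp add: W_def sum_nonneg)
  qed
  finally show ?thesis using q_le qk k0 unfolding W_def by (intro exI[of _ q]) auto
qed

section \<open>The second moment over all forms\<close>

lemma tau_weight_moment:
  fixes T :: real
  assumes "T \<ge> 1"
  shows "(\<Sum>u\<in>{-\<lfloor>T\<rfloor>..\<lfloor>T\<rfloor>}. real (tau_weight u) ^ R) \<le> 4 * 2 ^ R * T * (1 + ln T) ^ (2 ^ R)"
  using tau_weight_moment_progression[of T 1 0 1 R] assms
  by (simp add: divisor_tau_def abs_le_iff_floor_interval del: atLeastAtMost_iff)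

text \<open>Strictness ensures \<open>x > 1\<close>, and hence \<open>ln x > 0\<close>, for every \<open>x \<ge> ln H powr \<kappa>\<close>.\<close>

lemma ln_gt_one_of_ge_three:
  fixes H :: real
  assumes "H \<ge> 3"
  shows "ln H > 1"
proof -
  \<comment> \<open>The bound \<open>exp 1 < 3\<close> follows from \<open>1 / 3 < (5 / 6) ^ 6 \<le> exp (- 1)\<close>.\<close>
  have "(1 / 3 :: real) < (1 + (-1 / 6)) ^ 6" by (simp add: eval_nat_numeral)
  also have "\<dots> \<le> exp (-1 / 6) ^ 6" by (intro power_mono exp_ge_add_one_self) auto
  also have "\<dots> = exp (-1)" by (simp flip: exp_of_nat_mult)
  also have "\<dots> = 1 / exp 1" by (simp add: exp_minus divide_inverse)
  finally have "exp 1 < (3 :: real)" by (simp add: field_simps)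
  then have "exp 1 < H" using assms by linarith
  then show ?thesis using assms by (metis exp_gt_zero exp_ln ln_less_cancel_iff ln_exp less_le_trans zero_less_numeral)
qed

text \<open>This turns a bound that is linear in the discrepancy into a quadratic one, at the cost of \<open>1 / s\<close>.\<close>

lemma young_with_weight:
  fixes X s :: real
  assumes "s > 0"
  shows "X \<le> X\<^sup>2 * s + 1 / s"
proof -
  have "X * s \<le> (X * s)\<^sup>2 + 1"
  proof -
    have "2 * (X * s) \<le> (X * s)\<^sup>2 + 1"
      using sum_squares_bound[of "X * s" 1] by (simp only: power_one mult_1_right)
    then show ?thesis using zero_le_power2[of "X * s"] by linarith
  qed
  then have "X * s / s \<le> ((X * s)\<^sup>2 + 1) / s" using assms by (intro divide_right_mono) auto
  then show ?thesis using assms by (simp add: power2_eq_square add_divide_distrib)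
qed

lemma divisor_bounded_le_tau_weight:
  fixes f :: "int \<Rightarrow> complex"
  assumes "B > 0"
    and "\<And>n. n \<noteq> 0 \<Longrightarrow> norm (f n) \<le> B * real (divisor_tau (nat \<bar>n\<bar>)) powr C"
    and "norm (f 0) \<le> B"
  shows "norm (f n) \<le> B * real (tau_weight n) ^ nat \<lceil>C\<rceil>"
proof (cases "n = 0")
  case True
  then show ?thesis using assms(3) by (simp add: tau_weight_def divisor_tau_def)
next
  case False
  define t where "t = real (divisor_tau (nat \<bar>n\<bar>))"
  have t: "t \<ge> 1" using divisor_tau_pos[of "nat \<bar>n\<bar>"] False by (simp add: t_def)
  have "t powr C \<le> t powr real (nat \<lceil>C\<rceil>)" using t by (intro powr_mono) linarith+
  also have "\<dots> = t ^ nat \<lceil>C\<rceil>" using t by (simp add: powr_realpow)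
  finally have "B * t powr C \<le> B * t ^ nat \<lceil>C\<rceil>" using assms(1) by simp
  moreover have "real (tau_weight n) = t" using t by (simp add: tau_weight_def t_def max_def)
  ultimately show ?thesis using assms(2)[OF False] by (simp add: t_def)
qed

theorem theorem1p6:
  fixes B C N :: real and d :: nat
  assumes "B > 0" "C > 0" "N > 0" "d \<ge> 1"
  shows "\<exists>\<kappa> > 0. \<exists>K > 0. \<forall>f :: int \<Rightarrow> complex.
    (\<forall>n. n \<noteq> 0 \<longrightarrow> norm (f n) \<le> B * real (divisor_tau (nat \<bar>n\<bar>)) powr C) \<longrightarrow>
    norm (f 0) \<le> B \<longrightarrow>
    (\<forall>H x :: real. H \<ge> 3 \<longrightarrow> ln H powr \<kappa> \<le> x \<longrightarrow> x \<le> H \<longrightarrow>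
      1 / H ^ (1 + d) *
        (\<Sum>F\<in>binary_forms_upto d H.
           (norm (1 / of_real (x ^ 2) * (\<Sum>n\<in>int_box x. f (eval2 F n)))) ^ 2)
      \<le> K * (ln H powr \<kappa> * x ^ (4 * d) / H ^ 2 *
               (MAX q\<in>{q :: nat. q \<ge> 1 \<and> real q \<le> 2 * x ^ (2 * d)}.
                  (discrepancy f ((1 + real d) * x ^ d * H) q) ^ 2)
             + 1 / ln x powr N))"
proof -
  define r where "r = nat \<lceil>C\<rceil>"
  define R where "R = 2 * r"
  define A1 :: nat where "A1 = 2 ^ R"
  define A2 :: nat where "A2 = 2 ^ (R * (2 * d + 1))"
  obtain K1 where K1: "K1 > 0"
      "\<And>H x n. H \<ge> 3 \<Longrightarrow> 1 \<le> x \<Longrightarrow> x \<le> H \<Longrightarrow> n \<in> int_box x \<Longrightarrow>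
        (\<Sum>c\<in>coeff_vectors {0..d} H. real (tau_weight (form_value d c n)) ^ R)
          \<le> K1 * H ^ (d + 1) * ln H ^ A2 * x powr (1 / 4)"
    using form_moment[OF assms(4), of R] unfolding A2_def by blast
  obtain K3 :: real where K3: "K3 \<ge> 1" "\<And>x. x \<ge> 1 \<Longrightarrow> (1 + ln x) ^ nat \<lceil>N\<rceil> \<le> K3 * x powr (1 / 2)"
    using one_plus_ln_power_bound[of "1 / 2" "nat \<lceil>N\<rceil>"] by (metis half_gt_zero_iff zero_less_one)
  \<comment> \<open>The summand \<open>4 * A2\<close> gives \<open>ln H ^ A2 \<le> x powr (1 / 4)\<close> for degenerate pairs; \<open>2 * A1 + N\<close> pays for the
    squared logarithms and for the factor \<open>ln x powr N\<close> of the quadratic bound for the other pairs.\<close>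
  define \<kappa> where "\<kappa> = 2 * real A1 + 4 * real A2 + N"
  define Kw where "Kw = B * 4 * 2 ^ R * (1 + real d) * (2 * real d + 2) ^ A1"
  define Ka where "Ka = 81 * 3 ^ (d - 1) * 2 * Kw"
  define Kb where "Kb = 135 * B\<^sup>2 * K1 * K3"
  have pos: "Kw > 0" "Ka > 0" "Kb > 0" using assms K1 K3 by (auto simp: Kw_def Ka_def Kb_def)
  have "\<kappa> > 0" using assms by (simp add: \<kappa>_def add_nonneg_pos)
  have main: "1 / H ^ (1 + d) *
        (\<Sum>F\<in>binary_forms_upto d H. (norm (1 / of_real (x ^ 2) * (\<Sum>n\<in>int_box x. f (eval2 F n)))) ^ 2)
      \<le> (Ka + Kb) * (ln H powr \<kappa> * x ^ (4 * d) / H ^ 2 *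
               (MAX q\<in>{q :: nat. q \<ge> 1 \<and> real q \<le> 2 * x ^ (2 * d)}.
                  (discrepancy f ((1 + real d) * x ^ d * H) q) ^ 2)
             + 1 / ln x powr N)"
    if f: "\<And>n. n \<noteq> 0 \<Longrightarrow> norm (f n) \<le> B * real (divisor_tau (nat \<bar>n\<bar>)) powr C" "norm (f 0) \<le> B"
      and H: "H \<ge> 3" and x: "ln H powr \<kappa> \<le> x" "x \<le> H"
    for f :: "int \<Rightarrow> complex" and H x :: real
  proof -
    define L where "L = ln H"
    have L: "L > 1" using ln_gt_one_of_ge_three[OF H] by (simp add: L_def)
    have "1 < L powr \<kappa>" using L \<open>\<kappa> > 0\<close> by simp
    then have x1: "x > 1" using x by (simp add: L_def)
    define l where "l = ln x"
    have l: "l > 0" "l \<le> L" using x1 x H by (auto simp: l_def L_def)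
    define T where "T = (1 + real d) * x ^ d * H"
    have T1: "T \<ge> 1"
    proof -
      have "1 * 1 * 1 \<le> T" unfolding T_def using x1 H by (intro mult_mono one_le_power) auto
      then show ?thesis by simp
    qed
    define Q where "Q = {q :: nat. q \<ge> 1 \<and> real q \<le> 2 * x ^ (2 * d)}"
    define M where "M = (MAX q\<in>Q. (discrepancy f T q)\<^sup>2)"
    have finQ: "finite Q"
      by (rule finite_subset[of _ "{..nat \<lfloor>2 * x ^ (2 * d)\<rfloor>}"]) (auto simp: Q_def le_nat_floor)
    have M_ge: "(discrepancy f T q)\<^sup>2 \<le> M" if "q \<in> Q" for q
      unfolding M_def using finQ that by (intro Max_ge) auto
    have "1 \<le> x ^ (2 * d)" using x1 by (intro one_le_power) simp
    then have "real 1 \<le> 2 * x ^ (2 * d)" by linarith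
    then have "1 \<in> Q" by (simp add: Q_def)
    then have M0: "M \<ge> 0" using M_ge zero_le_power2 order_trans by blast
    define E where "E = sqrt M"
    have E: "E \<ge> 0" "E\<^sup>2 = M" using M0 by (simp_all add: E_def)
    have E_ge: "discrepancy f T q \<le> E" if "q \<in> Q" for q
      unfolding E_def using M_ge[OF that] by (intro real_le_rsqrt)
    have fw: "norm (f n) \<le> B * real (tau_weight n) ^ r" for n
      unfolding r_def using f assms(1) by (intro divisor_bounded_le_tau_weight) auto
    have w1: "real (tau_weight n) \<ge> 1" for n by (simp add: tau_weight_def)
    have fw2: "(norm (f n))\<^sup>2 \<le> B\<^sup>2 * real (tau_weight n) ^ R" for n
    proof -
      have "(norm (f n))\<^sup>2 \<le> (B * real (tau_weight n) ^ r)\<^sup>2" using fw by (intro power_mono) auto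
      then show ?thesis by (simp add: power_mult_distrib R_def power_mult[symmetric] mult.commute)
    qed
    define V where "V = coeff_vectors {0..d} H"
    define corr where "corr = (\<lambda>p. norm (\<Sum>c\<in>V. f (form_value d c (fst p)) * cnj (f (form_value d c (snd p)))))"
    define Dg where "Dg = {p \<in> int_box x \<times> int_box x.
      fst (fst p) ^ d * snd (snd p) ^ d - fst (snd p) ^ d * snd (fst p) ^ d = 0}"
    define Wb where "Wb = Kw * (x ^ d * H * L ^ A1)"
    define Ob where "Ob = (3 * H) ^ (d - 1) * (2 * E * Wb)"
    define Db where "Db = B\<^sup>2 * (K1 * H ^ (d + 1) * L ^ A2 * x powr (1 / 4))"
    have W: "(\<Sum>u\<in>{-\<lfloor>T\<rfloor>..\<lfloor>T\<rfloor>}. norm (f u)) \<le> Wb"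
    proof -
      have "(\<Sum>u\<in>{-\<lfloor>T\<rfloor>..\<lfloor>T\<rfloor>}. norm (f u)) \<le> (\<Sum>u\<in>{-\<lfloor>T\<rfloor>..\<lfloor>T\<rfloor>}. B * real (tau_weight u) ^ R)"
      proof (rule sum_mono)
        fix u
        have "real (tau_weight u) ^ r \<le> real (tau_weight u) ^ R"
          using w1 by (intro power_increasing) (auto simp: R_def)
        then show "norm (f u) \<le> B * real (tau_weight u) ^ R"
          using fw[of u] assms(1) by (meson mult_left_mono order_less_imp_le order_trans)
      qed
      also have "\<dots> \<le> B * (4 * 2 ^ R * T * (1 + ln T) ^ A1)"
        unfolding sum_distrib_left[symmetric] A1_def
        using assms T1 by (intro mult_left_mono tau_weight_moment) auto
      also have "\<dots> \<le> B * (4 * 2 ^ R * T * ((2 * real d + 2) * L) ^ A1)"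
      proof -
        have "T \<le> H ^ (2 * d + 1)" unfolding T_def using H x1 x by (intro form_range_le_power) auto
        then have "ln T \<le> ln (H ^ (2 * d + 1))" using T1 by simp
        also have "\<dots> = real (2 * d + 1) * L" unfolding L_def using H by (intro ln_realpow)
        finally have "1 + ln T \<le> (2 * real d + 2) * L" using L by (simp add: algebra_simps)
        then show ?thesis using assms T1 by (intro mult_left_mono power_mono) auto
      qed
      also have "\<dots> = Wb" by (simp add: Wb_def Kw_def T_def power_mult_distrib mult_ac)
      finally show ?thesis .
    qed
    have W0: "0 \<le> Wb" using pos x1 H L by (simp add: Wb_def)
    have Ob0: "0 \<le> Ob" using H E W0 by (simp add: Ob_def)
    have Db0: "0 \<le> Db" using H K1 L by (simp add: Db_def)
    have off: "corr p \<le> Ob" if p: "p \<in> int_box x \<times> int_box x" "p \<notin> Dg" for p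
    proof -
      obtain q where q: "q \<ge> 1" "real q \<le> 2 * x ^ (2 * d)"
        "corr p \<le> (3 * H) ^ (d - 1) * (2 * discrepancy f T q * (\<Sum>u\<in>{-\<lfloor>T\<rfloor>..\<lfloor>T\<rfloor>}. norm (f u)))"
        using form_correlation_le_discrepancy[of d H x "fst p" "snd p" f] assms(4) H x1 p
        unfolding corr_def V_def Dg_def T_def by auto
      have "discrepancy f T q \<le> E" using q by (intro E_ge) (auto simp: Q_def)
      then have "2 * discrepancy f T q * (\<Sum>u\<in>{-\<lfloor>T\<rfloor>..\<lfloor>T\<rfloor>}. norm (f u)) \<le> 2 * E * Wb"
        using W E discrepancy_nonneg[OF q(1), of T f] T1 by (intro mult_mono sum_nonneg) auto
      then have "(3 * H) ^ (d - 1) * (2 * discrepancy f T q * (\<Sum>u\<in>{-\<lfloor>T\<rfloor>..\<lfloor>T\<rfloor>}. norm (f u))) \<le> Ob"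
        unfolding Ob_def using H by (intro mult_left_mono) auto
      with q(3) show ?thesis by linarith
    qed
    have moment: "(\<Sum>c\<in>V. (norm (f (form_value d c n)))\<^sup>2) \<le> Db" if "n \<in> int_box x" for n
    proof -
      have "(\<Sum>c\<in>V. (norm (f (form_value d c n)))\<^sup>2) \<le> B\<^sup>2 * (\<Sum>c\<in>V. real (tau_weight (form_value d c n)) ^ R)"
        unfolding sum_distrib_left by (intro sum_mono fw2)
      also have "\<dots> \<le> Db"
        unfolding V_def Db_def L_def using H x1 x that by (intro mult_left_mono K1(2)) auto
      finally show ?thesis .
    qed
    have deg: "corr p \<le> Db" if "p \<in> int_box x \<times> int_box x" for p
      unfolding corr_def using that by (intro correlation_le_second_moments moment) auto
    have cardB: "real (card (int_box x \<times> int_box x)) \<le> 81 * x ^ 4"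
    proof -
      have "real (card (int_box x \<times> int_box x)) = real (card {-\<lfloor>x\<rfloor>..\<lfloor>x\<rfloor>}) ^ 4"
        by (simp add: int_box_eq card_cartesian_product power4_eq_xxxx del: card_atLeastAtMost_int)
      also have "\<dots> \<le> (3 * x) ^ 4" using x1 by (intro power_mono card_floor_interval_le) auto
      finally show ?thesis by (simp add: power_mult_distrib)
    qed
    have cardD: "real (card Dg) \<le> 135 * x ^ 3"
      unfolding Dg_def using x1 assms(4) by (intro card_degenerate_pairs) auto
    have "(\<Sum>c\<in>V. (norm (\<Sum>n\<in>int_box x. f (form_value d c n)))\<^sup>2) \<le> (\<Sum>p\<in>int_box x \<times> int_box x. corr p)"
      unfolding corr_def V_def by (intro sum_norm_square_le_pairs finite_coeff_vectors finite_int_box) simp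
    also have "\<dots> \<le> (\<Sum>p\<in>int_box x \<times> int_box x. Ob + (if p \<in> Dg then Db else 0))"
      using off deg Ob0 by (intro sum_mono) (auto simp: add_increasing)
    also have "\<dots> = real (card (int_box x \<times> int_box x)) * Ob + real (card Dg) * Db"
    proof -
      have "{p \<in> int_box x \<times> int_box x. p \<in> Dg} = Dg" by (auto simp: Dg_def)
      then show ?thesis
        by (simp add: sum.distrib finite_int_box flip: sum.inter_filter)
    qed
    also have "\<dots> \<le> 81 * x ^ 4 * Ob + 135 * x ^ 3 * Db"
      using cardB cardD Ob0 Db0 by (intro add_mono mult_right_mono)
    finally have total: "(\<Sum>c\<in>V. (norm (\<Sum>n\<in>int_box x. f (form_value d c n)))\<^sup>2)
      \<le> 81 * x ^ 4 * Ob + 135 * x ^ 3 * Db" .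
    define X where "X = E * x ^ d * L ^ A1 / H"
    have "1 / H ^ (1 + d) *
        (\<Sum>F\<in>binary_forms_upto d H. (norm (1 / of_real (x ^ 2) * (\<Sum>n\<in>int_box x. f (eval2 F n)))) ^ 2)
      = 1 / H ^ (1 + d) * (1 / x ^ 4 * (\<Sum>c\<in>V. (norm (\<Sum>n\<in>int_box x. f (form_value d c n)))\<^sup>2))"
    proof -
      have scale: "(norm (1 / of_real (x ^ 2) * S))\<^sup>2 = 1 / x ^ 4 * (norm S)\<^sup>2" for S :: complex
        by (simp add: norm_mult norm_divide norm_power power_mult_distrib power_divide flip: power_mult)
      have "(\<Sum>F\<in>binary_forms_upto d H. (norm (1 / of_real (x ^ 2) * (\<Sum>n\<in>int_box x. f (eval2 F n)))) ^ 2)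
          = (\<Sum>c\<in>V. (norm (1 / of_real (x ^ 2) * (\<Sum>n\<in>int_box x. f (form_value d c n)))) ^ 2)"
        unfolding V_def using H
        by (intro sum_binary_forms_upto[where G = "\<lambda>F. (norm (1 / of_real (x ^ 2) * (\<Sum>n\<in>int_box x. f (F n)))) ^ 2"]) simp
      also have "\<dots> = 1 / x ^ 4 * (\<Sum>c\<in>V. (norm (\<Sum>n\<in>int_box x. f (form_value d c n)))\<^sup>2)"
        by (simp only: scale sum_distrib_left[symmetric])
      finally show ?thesis by simp
    qed
    also have "\<dots> \<le> 1 / H ^ (1 + d) * (1 / x ^ 4 * (81 * x ^ 4 * Ob + 135 * x ^ 3 * Db))"
      using total x1 H by (intro mult_left_mono) auto
    also have "\<dots> = Ka * X + 135 * B\<^sup>2 * K1 * (L ^ A2 * x powr (1 / 4) / x)"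
    proof -
      have Hd: "H ^ (1 + d) = H ^ (d - 1) * H\<^sup>2" using assms(4) by (simp flip: power_add)
      have "1 / H ^ (1 + d) * (1 / x ^ 4 * (81 * x ^ 4 * Ob)) = Ka * X"
        unfolding Hd Ob_def Wb_def Ka_def X_def using x1 H
        by (simp add: power_mult_distrib field_simps power2_eq_square)
      moreover have "1 / H ^ (1 + d) * (1 / x ^ 4 * (135 * x ^ 3 * Db)) = 135 * B\<^sup>2 * K1 * (L ^ A2 * x powr (1 / 4) / x)"
        unfolding Db_def using x1 H by (simp add: field_simps power_Suc power4_eq_xxxx power3_eq_cube)
      ultimately show ?thesis by (simp only: distrib_left)
    qed
    also have "\<dots> \<le> Ka * (L powr \<kappa> * x ^ (4 * d) / H\<^sup>2 * M + 1 / l powr N) + Kb * (1 / l powr N)"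
    proof (rule add_mono)
      have "X \<le> X\<^sup>2 * l powr N + 1 / l powr N" using l by (intro young_with_weight) auto
      also have "X\<^sup>2 * l powr N \<le> L powr \<kappa> * x ^ (4 * d) / H\<^sup>2 * M"
      proof -
        have "X\<^sup>2 * l powr N = (M / H\<^sup>2) * x ^ (2 * d) * (L ^ (2 * A1) * l powr N)"
          by (simp add: X_def power_divide power_mult_distrib E(2) power_mult[symmetric] mult.commute mult_ac)
        also have "\<dots> \<le> (M / H\<^sup>2) * x ^ (4 * d) * (L powr \<kappa>)"
        proof (rule mult_mono)
          show "M / H\<^sup>2 * x ^ (2 * d) \<le> M / H\<^sup>2 * x ^ (4 * d)"
            using M0 x1 by (intro mult_left_mono power_increasing) auto
          have "L ^ (2 * A1) * l powr N \<le> L powr real (2 * A1) * L powr N"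
            using l L assms powr_realpow[of L "2 * A1"] by (intro mult_mono powr_mono2) auto
          also have "\<dots> = L powr (real (2 * A1) + N)" by (simp add: powr_add)
          also have "\<dots> \<le> L powr \<kappa>" using L by (intro powr_mono) (auto simp: \<kappa>_def)
          finally show "L ^ (2 * A1) * l powr N \<le> L powr \<kappa>" .
        qed (use M0 x1 L in auto)
        finally show ?thesis by (simp add: mult_ac)
      qed
      finally show "Ka * X \<le> Ka * (L powr \<kappa> * x ^ (4 * d) / H\<^sup>2 * M + 1 / l powr N)"
        using pos by (intro mult_left_mono) auto
      \<comment> \<open>The degenerate pairs save \<open>1 / x\<close>; the coefficient moments and the powers of the logarithm cost
        \<open>x powr (1 / 4)\<close> each.\<close>
      have "L ^ A2 \<le> x powr (1 / 4)"
      proof -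
        have "L ^ A2 = (L powr (4 * real A2)) powr (1 / 4)" using L by (simp add: powr_powr powr_realpow)
        also have "\<dots> \<le> x powr (1 / 4)"
        proof (rule powr_mono2)
          have "L powr (4 * real A2) \<le> L powr \<kappa>" using L assms by (intro powr_mono) (auto simp: \<kappa>_def)
          then show "L powr (4 * real A2) \<le> x" using x(1) by (simp add: L_def)
        qed auto
        finally show ?thesis .
      qed
      then have "L ^ A2 * x powr (1 / 4) / x \<le> x powr (1 / 4) * x powr (1 / 4) / x"
        using x1 by (intro divide_right_mono mult_right_mono) auto
      also have "\<dots> = 1 / x powr (1 / 2)"
      proof -
        have "x powr (1 / 4) * x powr (1 / 4) = x powr (1 / 2)" "x powr (1 / 2) * x powr (1 / 2) = x"
          using x1 by (simp_all flip: powr_add)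
        then have "x powr (1 / 4) * x powr (1 / 4) / x = x powr (1 / 2) / (x powr (1 / 2) * x powr (1 / 2))"
          by (simp only:)
        then show ?thesis using x1 by simp
      qed
      also have "\<dots> \<le> K3 * (1 / l powr N)"
      proof -
        have "l powr N \<le> (1 + l) powr N" using l assms by (intro powr_mono2) auto
        also have "\<dots> \<le> (1 + l) powr real (nat \<lceil>N\<rceil>)" using l by (intro powr_mono) linarith+
        also have "\<dots> = (1 + ln x) ^ nat \<lceil>N\<rceil>" using l by (simp add: powr_realpow l_def)
        also have "\<dots> \<le> K3 * x powr (1 / 2)" using x1 by (intro K3) auto
        finally show ?thesis using l x1 by (simp add: field_simps)
      qed
      finally have "L ^ A2 * x powr (1 / 4) / x \<le> K3 * (1 / l powr N)" .
      then have "135 * B\<^sup>2 * K1 * (L ^ A2 * x powr (1 / 4) / x) \<le> 135 * B\<^sup>2 * K1 * (K3 * (1 / l powr N))"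
        using K1 by (intro mult_left_mono) auto
      then show "135 * B\<^sup>2 * K1 * (L ^ A2 * x powr (1 / 4) / x) \<le> Kb * (1 / l powr N)"
        by (simp add: Kb_def mult.assoc)
    qed
    also have "\<dots> \<le> (Ka + Kb) * (L powr \<kappa> * x ^ (4 * d) / H\<^sup>2 * M + 1 / l powr N)"
    proof -
      have "0 \<le> Kb * (L powr \<kappa> * x ^ (4 * d) / H\<^sup>2 * M)"
        using pos M0 x1 by (intro mult_nonneg_nonneg divide_nonneg_nonneg) auto
      then show ?thesis by (simp only: distrib_left distrib_right)
    qed
    finally show ?thesis by (simp only: L_def l_def M_def Q_def T_def)
  qed
  have "Ka + Kb > 0" using pos by simp
  with \<open>\<kappa> > 0\<close> main show ?thesis by blast
qed

end
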